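(* Let $n\geq 4$ be an integer, let $G=\mathrm{Sym}(n)$ be the symmetric group on $n$ letters, and let $Z_n$ be the set of all $n$-cycles in $G$. Let $\Gamma_n=\mathrm{Cay}(G,Z_n)$. Then $\Gamma_n$ is an integral hyperenergetic graph, its energy is $\mathcal{E}(\Gamma_n)=2^{n-1}(n-1)!$, and its nullity is $\eta(\Gamma_n)=n!-\binom{2n-2}{n-1}$.
   Context: For a finite group $G$ and an inverse-closed subset $S\subseteq G$ with $1\notin S$, the Cayley graph $\mathrm{Cay}(G,S)$ has vertex set $G$, with $u,v$ adjacent iff $v=au$ for some $a\in S$. The eigenvalues of a simple graph are the eigenvalues of its adjacency matrix. A graph is integral if all its eigenvalues are integers. The energy $\mathcal{E}(\Gamma)$ of a graph $\Gamma$ is the sum of the absolute values of its eigenvalues (with multiplicity). A simple graph $\Gamma$ on $N$ vertices is hyperenergetic if $\mathcal{E}(\Gamma)>2N-2$. The nullity $\eta(\Gamma)$ is the multiplicity of $0$ as an eigenvalue of $\Gamma$. *)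

theory Defs
  imports Complex_Main "HOL-Computational_Algebra.Computational_Algebra"
    "HOL-Combinatorics.Combinatorics"
begin

text \<open>A simple graph is given by a finite vertex set V and an adjacency relation E.
  Its characteristic polynomial det(x I - A), with A the adjacency matrix, is written
  out via the Leibniz formula over permutations of V (basis-free, no ordering needed).\<close>
definition graph_charpoly :: "'a set \<Rightarrow> ('a \<Rightarrow> 'a \<Rightarrow> bool) \<Rightarrow> complex poly" where
  "graph_charpoly V E =
     (\<Sum>p | p permutes V. of_int (sign p) *
        (\<Prod>v\<in>V. (if p v = v then [:0, 1:] else 0) - (if E v (p v) then 1 else 0)))"

definition graph_eigenvalues :: "'a set \<Rightarrow> ('a \<Rightarrow> 'a \<Rightarrow> bool) \<Rightarrow> complex multiset" where
  "graph_eigenvalues V E = proots (graph_charpoly V E)"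

definition graph_integral :: "'a set \<Rightarrow> ('a \<Rightarrow> 'a \<Rightarrow> bool) \<Rightarrow> bool" where
  "graph_integral V E \<longleftrightarrow> (\<forall>e\<in>#graph_eigenvalues V E. e \<in> \<int>)"

definition graph_energy :: "'a set \<Rightarrow> ('a \<Rightarrow> 'a \<Rightarrow> bool) \<Rightarrow> real" where
  "graph_energy V E = (\<Sum>e\<in>#graph_eigenvalues V E. cmod e)"

definition hyperenergetic :: "'a set \<Rightarrow> ('a \<Rightarrow> 'a \<Rightarrow> bool) \<Rightarrow> bool" where
  "hyperenergetic V E \<longleftrightarrow> graph_energy V E > 2 * real (card V) - 2"

definition graph_nullity :: "'a set \<Rightarrow> ('a \<Rightarrow> 'a \<Rightarrow> bool) \<Rightarrow> nat" where
  "graph_nullity V E = count (graph_eigenvalues V E) 0"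

definition cayley_adj :: "('b \<Rightarrow> 'b) set \<Rightarrow> ('b \<Rightarrow> 'b) \<Rightarrow> ('b \<Rightarrow> 'b) \<Rightarrow> bool" where
  "cayley_adj S u v \<longleftrightarrow> (\<exists>a\<in>S. v = a \<circ> u)"

definition Sym :: "nat \<Rightarrow> (nat \<Rightarrow> nat) set" where
  "Sym n = {p. p permutes {1..n}}"

definition full_cycles :: "nat \<Rightarrow> (nat \<Rightarrow> nat) set" where
  "full_cycles n = {p. \<exists>cs. distinct cs \<and> set cs = {1..n} \<and> p = cycle_of_list cs}"

end

theory Submission
  imports Defs "Jordan_Normal_Form.Schur_Decomposition"
begin

text \<open>
  Let \<open>\<chi>\<^sub>k\<close> be the character of the k-th exterior power of the standard representation of
  \<open>Sym X\<close>, \<open>n = card X\<close>; it has degree \<open>n - 1 choose k\<close> (hook shape \<open>(n - k, 1\<^sup>k)\<close>). Two facts suffice.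
  First, the alternating sum of the \<open>\<chi>\<^sub>k\<close> is n times the indicator of the n-cycles. Second, summing
  \<open>\<chi>\<^sub>k\<close> over the left translates by all n-cycles multiplies it by
  \<open>\<lambda>\<^sub>k = (-1)\<^sup>k k! (n - 1 - k)!\<close>. Together they express every power of the adjacency matrix through
  the \<open>\<chi>\<^sub>k\<close> and give its power traces as the sum over k of \<open>(n - 1 choose k)\<^sup>2 \<lambda>\<^sub>k\<^sup>m\<close>, which
  determines the nonzero spectrum. Both facts are proved by direct sign counting, so neither
  irreducibility nor Schur orthogonality is needed.
\<close>

section \<open>Signs on invariant sets\<close>

text \<open>A class sum acts on an irreducible representation by class size times character value
  over degree. For the n-cycles and \<open>\<chi>\<^sub>k\<close> this is
  \<open>(-1)^k * (n-1)! / (n - 1 choose k)\<close>, the origin of \<open>\<lambda>\<^sub>k\<close>.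
  The obstacle is to verify this scalar with signs only. Signs are visible in the permutation
  representation, which is the standard representation plus a trivial line; its k-th exterior power
  therefore has character \<open>\<chi>\<^sub>k\<close> plus
  \<open>\<chi>\<^sub>k\<^sub>-\<^sub>1\<close> (whence the recursion for \<open>hook_char\<close>)
  and mixes two eigenvalues. They are separated by \<open>swap_char\<close>: summing
  \<open>ext_char\<close> over the translates by all n-cycles gives a multiple of
  \<open>swap_char\<close>, which is an explicit combination of the two hook characters. Only traces
  of positive powers are computed, so the eigenvalue 0 stays invisible to them; its multiplicity is
  what remains of the total n!. Integrality, energy and nullity all become spectral sums of
  functions vanishing at 0.\<close>

text \<open>
  \<open>restr_sign p I\<close> is the diagonal entry at the basis vector indexed by I of the action of p on an
  exterior power of the permutation representation. A full cycle on S is encoded as a permutation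
  without proper nonempty invariant subsets, which makes merging and splitting of cycles simple.
\<close>

definition restr_sign :: "('a \<Rightarrow> 'a) \<Rightarrow> 'a set \<Rightarrow> int" where
  "restr_sign p I = (if p ` I = I then sign (perm_restrict p I) else 0)"

definition cycles_on :: "'a set \<Rightarrow> ('a \<Rightarrow> 'a) set" where
  "cycles_on S = {p. p permutes S \<and> (\<forall>T\<subseteq>S. p ` T = T \<longrightarrow> T = {} \<or> T = S)}"

lemma perm_restrict_permutes:
  assumes "finite I" "p ` I = I"
  shows "perm_restrict p I permutes I"
proof (rule bij_imp_permutes)
  have "bij_betw p I I"
    using assms by (simp add: bij_betw_def eq_card_imp_inj_on)
  then show "bij_betw (perm_restrict p I) I I"
    by (rule bij_betw_cong[THEN iffD1, rotated]) (simp add: perm_restrict_def)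
qed (simp add: perm_restrict_def)

lemma permutation_perm_restrict:
  assumes "finite I" "p ` I = I"
  shows "permutation (perm_restrict p I)"
  using perm_restrict_permutes[OF assms] assms(1) permutes_imp_permutation by blast

lemma restr_sign_cong:
  assumes "\<And>v. v \<in> I \<Longrightarrow> p v = q v"
  shows "restr_sign p I = restr_sign q I"
proof -
  have "p ` I = q ` I" "perm_restrict p I = perm_restrict q I"
    using assms by (auto simp: perm_restrict_def fun_eq_iff)
  then show ?thesis by (simp add: restr_sign_def)
qed

lemma restr_sign_empty [simp]: "restr_sign p {} = 1"
proof -
  have "perm_restrict p {} = id" by (auto simp: perm_restrict_def)
  then show ?thesis by (simp add: restr_sign_def)
qed

lemma restr_sign_permutes: "p permutes S \<Longrightarrow> restr_sign p S = sign p"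
  by (simp add: restr_sign_def permutes_image)

lemma restr_sign_id [simp]: "restr_sign id I = 1"
proof -
  have "perm_restrict id I = id" by (auto simp: perm_restrict_def)
  then show ?thesis by (simp add: restr_sign_def)
qed

text \<open>A diagonal entry of a product is in general a sum over intermediate basis vectors. When
  \<open>q\<close> stabilises \<open>I\<close>, it maps the basis vector of \<open>I\<close> to a
  multiple of itself, and a single summand is left.\<close>

lemma restr_sign_comp:
  assumes "finite I" "q ` I = I"
  shows "restr_sign (p \<circ> q) I = restr_sign p I * restr_sign q I"
proof (cases "p ` I = I")
  case True
  have "perm_restrict (p \<circ> q) I = perm_restrict p I \<circ> perm_restrict q I"
    using assms(2) by (auto simp: perm_restrict_def fun_eq_iff)
  moreover have "(p \<circ> q) ` I = I" using True assms(2) by (metis image_comp)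
  ultimately show ?thesis
    using assms True by (simp add: restr_sign_def sign_compose permutation_perm_restrict)
next
  case False
  then have "(p \<circ> q) ` I \<noteq> I" using assms(2) by (metis image_comp)
  with False show ?thesis by (simp add: restr_sign_def)
qed

lemma restr_sign_union:
  assumes "finite I" "finite J" "I \<inter> J = {}" "p ` I = I" "p ` J = J"
  shows "restr_sign p (I \<union> J) = restr_sign p I * restr_sign p J"
proof -
  have "perm_restrict p I \<circ> perm_restrict p J = perm_restrict p (I \<union> J)"
    using assms by (intro perm_restrict_union perm_restrict_permutes) auto
  then show ?thesis
    using assms permutation_perm_restrict[of I p] permutation_perm_restrict[of J p]
    by (simp add: restr_sign_def image_Un sign_compose[symmetric])
qed

lemma restr_sign_insert_fixed:
  assumes "inj p" "p y = y" "y \<notin> L"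
  shows "restr_sign p (insert y L) = restr_sign p L"
proof -
  have "p ` insert y L = insert y L \<longleftrightarrow> p ` L = L"
    using assms by (auto simp: inj_image_mem_iff) (metis assms inj_image_mem_iff insert_ident)+
  moreover have "perm_restrict p (insert y L) = perm_restrict p L"
    using assms by (auto simp: perm_restrict_def fun_eq_iff)
  ultimately show ?thesis by (simp add: restr_sign_def)
qed

lemma restr_sign_transpose:
  assumes "finite I" "y \<in> I" "z \<in> I" "y \<noteq> z"
  shows "restr_sign (Transposition.transpose y z) I = -1"
proof -
  have "perm_restrict (Transposition.transpose y z) I = Transposition.transpose y z"
    using assms by (auto simp: perm_restrict_def fun_eq_iff transpose_def)
  then show ?thesis using assms by (simp add: restr_sign_def sign_swap_id)
qed

lemma restr_sign_transpose_comp: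
  assumes "finite I" "y \<in> I" "z \<in> I" "y \<noteq> z"
  shows "restr_sign (Transposition.transpose y z \<circ> p) I = - restr_sign p I"
proof (cases "p ` I = I")
  case True
  then show ?thesis using assms by (simp add: restr_sign_comp restr_sign_transpose)
next
  case False
  have "p ` I = I" if "(Transposition.transpose y z \<circ> p) ` I = I"
  proof -
    have "Transposition.transpose y z ` (Transposition.transpose y z \<circ> p) ` I = I"
      using that assms by simp
    then show ?thesis by (simp add: image_comp comp_assoc[symmetric])
  qed
  with False show ?thesis by (auto simp: restr_sign_def)
qed

lemma transpose_image_swap:
  assumes "y \<in> I" "x \<notin> I"
  shows "Transposition.transpose x y ` I = insert x (I - {y})"
proof -
  have "Transposition.transpose x y ` insert y (I - {y}) = insert x (I - {y})"
    using assms by (subst image_insert) (auto simp: transpose_def image_iff)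
  then show ?thesis using assms by (simp add: insert_absorb)
qed

lemma transpose_comp_image_eq_iff:
  "(Transposition.transpose x y \<circ> p) ` I = I \<longleftrightarrow> p ` I = Transposition.transpose x y ` I"
proof -
  have "Transposition.transpose x y ` A = I \<longleftrightarrow> A = Transposition.transpose x y ` I" for A
    by (auto simp: image_comp)
  from this[of "p ` I"] show ?thesis by (simp add: image_comp)
qed

section \<open>Full cycles\<close>

text \<open>Composing with a transposition across two cycles merges them. A set containing both or
  neither of \<open>x\<close> and \<open>y\<close> is invariant under \<open>q\<close> exactly when
  it is invariant under the composite. Sets separating the two points are handled by passing to the
  complement in \<open>I\<close> or \<open>J\<close> in one direction, and by a cardinality count in
  the other.\<close>

lemma cycles_on_transpose_iff:
  assumes fin: "finite I" "finite J" and disj: "I \<inter> J = {}" and y: "y \<in> I" and x: "x \<in> J"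
    and qI: "q ` I = I" and q: "q permutes (I \<union> J)"
  shows "q \<circ> Transposition.transpose x y \<in> cycles_on (I \<union> J) \<longleftrightarrow>
    perm_restrict q I \<in> cycles_on I \<and> perm_restrict q J \<in> cycles_on J"
proof -
  let ?t = "Transposition.transpose x y"
  have inj: "inj q" using q by (rule permutes_inj)
  have qJ: "q ` J = J"
  proof -
    have "q ` ((I \<union> J) - I) = (I \<union> J) - I"
      using inj qI permutes_image[OF q] by (simp add: image_set_diff)
    moreover have "(I \<union> J) - I = J" using disj by blast
    ultimately show ?thesis by simp
  qed
  have perm: "q \<circ> ?t permutes (I \<union> J)"
    using x y q by (intro permutes_compose permutes_swap_id) auto
  have rI: "perm_restrict q I ` T = q ` T" if "T \<subseteq> I" for T
    using that by (force simp: perm_restrict_def image_iff)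
  have rJ: "perm_restrict q J ` T = q ` T" if "T \<subseteq> J" for T
    using that by (force simp: perm_restrict_def image_iff)
  have aux: "T = {}" if "T \<subseteq> I \<union> J" "x \<notin> T" "y \<notin> T" "q ` T = T" "q \<circ> ?t \<in> cycles_on (I \<union> J)" for T
  proof -
    have "?t ` T = T" using that by simp
    then have "(q \<circ> ?t) ` T = T" using that by (metis image_comp)
    with that show ?thesis using x unfolding cycles_on_def by blast
  qed
  show ?thesis
  proof
    assume L: "q \<circ> ?t \<in> cycles_on (I \<union> J)"
    have "T = {} \<or> T = I" if T: "T \<subseteq> I" "q ` T = T" for T
    proof (cases "y \<in> T")
      case True
      have "q ` (I - T) = I - T" using inj qI T by (simp add: image_set_diff)
      then have "I - T = {}" using True x disj by (intro aux[OF _ _ _ _ L]) auto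
      then show ?thesis using T by blast
    next
      case False
      then show ?thesis using aux[OF _ _ _ _ L, of T] T x disj by blast
    qed
    moreover have "T = {} \<or> T = J" if T: "T \<subseteq> J" "q ` T = T" for T
    proof (cases "x \<in> T")
      case True
      have "q ` (J - T) = J - T" using inj qJ T by (simp add: image_set_diff)
      then have "J - T = {}" using True y disj by (intro aux[OF _ _ _ _ L]) auto
      then show ?thesis using T by blast
    next
      case False
      then show ?thesis using aux[OF _ _ _ _ L, of T] T y disj by blast
    qed
    ultimately show "perm_restrict q I \<in> cycles_on I \<and> perm_restrict q J \<in> cycles_on J"
      unfolding cycles_on_def using rI rJ fin qI qJ by (auto intro: perm_restrict_permutes)
  next
    assume R: "perm_restrict q I \<in> cycles_on I \<and> perm_restrict q J \<in> cycles_on J"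
    then have cI: "T = {} \<or> T = I" if "T \<subseteq> I" "q ` T = T" for T
      using that rI[of T] unfolding cycles_on_def by auto
    have cJ: "T = {} \<or> T = J" if "T \<subseteq> J" "q ` T = T" for T
      using R that rJ[of T] unfolding cycles_on_def by auto
    have "T = {} \<or> T = I \<union> J" if T: "T \<subseteq> I \<union> J" "(q \<circ> ?t) ` T = T" for T
    proof -
      have fT: "finite T" using T fin by (meson finite_UnI finite_subset)
      have I_part: "q ` (?t ` T \<inter> I) = T \<inter> I"
        using T(2) qI image_Int[OF inj, of "?t ` T" I] by (simp add: image_comp)
      have J_part: "q ` (?t ` T \<inter> J) = T \<inter> J"
        using T(2) qJ image_Int[OF inj, of "?t ` T" J] by (simp add: image_comp)
      have xy: "x \<in> T \<longleftrightarrow> y \<in> T"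
      proof (rule ccontr)
        \<comment> \<open>If \<open>T\<close> contains just one of the two points, \<open>?t\<close>
          carries that point out of its own part, and \<open>q\<close> would map a set with one
          element fewer onto the intersection of \<open>T\<close> with that part.\<close>
        assume "(x \<in> T) \<noteq> (y \<in> T)"
        then consider "x \<in> T" "y \<notin> T" | "y \<in> T" "x \<notin> T" by blast
        then show False
        proof cases
          case 1
          then have "?t ` T = insert y (T - {x})"
            using transpose_image_swap[of x T y] by (simp add: transpose_commute)
          then have "?t ` T \<inter> J = (T \<inter> J) - {x}" using y disj by auto
          then have "card ((T \<inter> J) - {x}) = card (T \<inter> J)"
            using J_part card_image[of q "(T \<inter> J) - {x}"] inj by (metis inj_on_subset subset_UNIV)
          moreover have "card ((T \<inter> J) - {x}) < card (T \<inter> J)"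
            using 1 x fT by (intro card_Diff1_less) auto
          ultimately show False by simp
        next
          case 2
          then have "?t ` T = insert x (T - {y})"
            using transpose_image_swap[of y T x] by simp
          then have "?t ` T \<inter> I = (T \<inter> I) - {y}" using x disj by auto
          then have "card ((T \<inter> I) - {y}) = card (T \<inter> I)"
            using I_part card_image[of q "(T \<inter> I) - {y}"] inj by (metis inj_on_subset subset_UNIV)
          moreover have "card ((T \<inter> I) - {y}) < card (T \<inter> I)"
            using 2 y fT by (intro card_Diff1_less) auto
          ultimately show False by simp
        qed
      qed
      then have tT: "?t ` T = T" by simp
      from cI[of "T \<inter> I"] cJ[of "T \<inter> J"] I_part J_part
      have "(T \<inter> I = {} \<or> T \<inter> I = I) \<and> (T \<inter> J = {} \<or> T \<inter> J = J)" by (simp add: tT)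
      then show ?thesis using T xy x y by blast
    qed
    then show "q \<circ> ?t \<in> cycles_on (I \<union> J)" unfolding cycles_on_def using perm by auto
  qed
qed

text \<open>The inverse cuts the long cycle by the transposition and restricts to the two pieces.
  With \<open>J\<close> a singleton this counts full cycles inductively; with \<open>J\<close> the
  complement of \<open>I\<close> it evaluates signed sums over full cycles.\<close>

lemma bij_betw_cycles_on_join:
  assumes fin: "finite I" "finite J" and disj: "I \<inter> J = {}" and y: "y \<in> I" and x: "x \<in> J"
  shows "bij_betw (\<lambda>(q, r). q \<circ> r \<circ> Transposition.transpose x y) (cycles_on I \<times> cycles_on J)
    {a \<in> cycles_on (I \<union> J). (a \<circ> Transposition.transpose x y) ` I = I}"
proof -
  let ?t = "Transposition.transpose x y"
  have img: "(q \<circ> r) ` I = I \<and> q \<circ> r permutes (I \<union> J) \<and> perm_restrict (q \<circ> r) I = q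
    \<and> perm_restrict (q \<circ> r) J = r" if "q permutes I" "r permutes J" for q r
  proof (intro conjI)
    have rI: "r v = v" if "v \<in> I" for v using that \<open>r permutes J\<close> disj by (meson disjoint_iff permutes_not_in)
    have qJ: "q v = v" if "v \<in> J" for v using that \<open>q permutes I\<close> disj by (meson disjoint_iff permutes_not_in)
    have "(q \<circ> r) ` I = q ` I" using rI by force
    then show "(q \<circ> r) ` I = I" using that by (simp add: permutes_image)
    show "q \<circ> r permutes (I \<union> J)"
      using that by (meson permutes_compose permutes_subset sup_ge1 sup_ge2)
    show "perm_restrict (q \<circ> r) I = q"
      using that rI by (auto simp: perm_restrict_def fun_eq_iff permutes_not_in)
    show "perm_restrict (q \<circ> r) J = r"
      using that qJ permutes_in_image[OF that(2)] by (auto simp: perm_restrict_def fun_eq_iff permutes_not_in)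
  qed
  have perm: "q permutes S" if "q \<in> cycles_on S" for q :: "'a \<Rightarrow> 'a" and S
    using that by (simp add: cycles_on_def)
  show ?thesis
  proof (rule bij_betw_byWitness[where
        f' = "\<lambda>a. (perm_restrict (a \<circ> ?t) I, perm_restrict (a \<circ> ?t) J)"])
    show "\<forall>a\<in>cycles_on I \<times> cycles_on J.
       (perm_restrict ((case a of (q, r) \<Rightarrow> q \<circ> r \<circ> ?t) \<circ> ?t) I,
        perm_restrict ((case a of (q, r) \<Rightarrow> q \<circ> r \<circ> ?t) \<circ> ?t) J) = a"
      using img perm by (auto simp: comp_assoc)
    have dec: "perm_restrict (a \<circ> ?t) I \<in> cycles_on I \<and> perm_restrict (a \<circ> ?t) J \<in> cycles_on J \<and>
       perm_restrict (a \<circ> ?t) I \<circ> perm_restrict (a \<circ> ?t) J \<circ> ?t = a"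
      if a: "a \<in> cycles_on (I \<union> J)" "(a \<circ> ?t) ` I = I" for a
    proof -
      have p: "a \<circ> ?t permutes (I \<union> J)"
        using x y perm[OF a(1)] by (intro permutes_compose permutes_swap_id) auto
      have "(a \<circ> ?t) \<circ> ?t \<in> cycles_on (I \<union> J)" using a by (simp add: comp_assoc)
      then have c: "perm_restrict (a \<circ> ?t) I \<in> cycles_on I" "perm_restrict (a \<circ> ?t) J \<in> cycles_on J"
        using cycles_on_transpose_iff[OF fin disj y x a(2) p] by auto
      then have "perm_restrict (a \<circ> ?t) I \<circ> perm_restrict (a \<circ> ?t) J = a \<circ> ?t"
        using perm_restrict_union[OF perm[OF c(1)] perm[OF c(2)] disj] p by simp
      with c show ?thesis by (simp add: comp_assoc)
    qed
    then show "\<forall>a\<in>{a \<in> cycles_on (I \<union> J). (a \<circ> ?t) ` I = I}.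
       (case (perm_restrict (a \<circ> ?t) I, perm_restrict (a \<circ> ?t) J) of (q, r) \<Rightarrow> q \<circ> r \<circ> ?t) = a"
      by auto
    have "q \<circ> r \<circ> ?t \<in> {a \<in> cycles_on (I \<union> J). (a \<circ> ?t) ` I = I}"
      if qr: "q \<in> cycles_on I" "r \<in> cycles_on J" for q r
    proof -
      note i = img[OF perm[OF qr(1)] perm[OF qr(2)]]
      have "q \<circ> r \<circ> ?t \<in> cycles_on (I \<union> J)"
        using cycles_on_transpose_iff[OF fin disj y x, of "q \<circ> r"] i qr by simp
      moreover have "q \<circ> r \<circ> ?t \<circ> ?t = q \<circ> r" by (simp add: comp_assoc)
      ultimately show ?thesis using i by simp
    qed
    then show "(\<lambda>(q, r). q \<circ> r \<circ> ?t) ` (cycles_on I \<times> cycles_on J)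
      \<subseteq> {a \<in> cycles_on (I \<union> J). (a \<circ> ?t) ` I = I}"
      by fast
    show "(\<lambda>a. (perm_restrict (a \<circ> ?t) I, perm_restrict (a \<circ> ?t) J)) `
      {a \<in> cycles_on (I \<union> J). (a \<circ> ?t) ` I = I} \<subseteq> cycles_on I \<times> cycles_on J"
      using dec by auto
  qed
qed

lemma finite_cycles_on: "finite S \<Longrightarrow> finite (cycles_on S)"
  unfolding cycles_on_def by (rule finite_subset[OF _ finite_permutations]) auto

lemma cycles_on_singleton [simp]: "cycles_on {x} = {id}"
  by (auto simp: cycles_on_def)

text \<open>Cutting \<open>x\<close> out of a full cycle leaves a full cycle on the nonempty set
  \<open>S\<close>, and the only datum lost is the predecessor of \<open>x\<close>. So each
  \<open>y\<close> in \<open>S\<close> contributes one copy of \<open>cycles_on S\<close>, and each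
  cut removes one transposition.\<close>

lemma card_and_sign_cycles_on:
  assumes "finite S"
  shows "card (cycles_on S) = fact (card S - 1)
    \<and> (\<forall>p\<in>cycles_on S. sign p = (-1) ^ (card S - 1))"
  using assms
proof (induction S)
  case empty
  have "cycles_on {} = {id :: 'a \<Rightarrow> 'a}" by (auto simp: cycles_on_def)
  then show ?case by simp
next
  case (insert x S)
  show ?case
  proof (cases "S = {}")
    case True
    then show ?thesis by simp
  next
    case False
    \<comment> \<open>These are the full cycles with \<open>a y = x\<close>: the composite sends
      \<open>x\<close> to \<open>a y\<close>, and it stabilises \<open>S\<close> exactly when it
      fixes \<open>x\<close>.\<close>
    let ?B = "\<lambda>y. {a \<in> cycles_on (insert x S). (a \<circ> Transposition.transpose x y) ` S = S}"
    have disj: "S \<inter> {x} = {}" and SU: "S \<union> {x} = insert x S" using insert by auto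
    have bij: "bij_betw (\<lambda>(q, r). q \<circ> r \<circ> Transposition.transpose x y) (cycles_on S \<times> {id}) (?B y)"
      if "y \<in> S" for y
      using bij_betw_cycles_on_join[OF insert.hyps(1) _ disj that, of x] unfolding SU by simp
    have ex: "\<exists>y\<in>S. a \<in> ?B y" if a: "a \<in> cycles_on (insert x S)" for a
    proof -
      have p: "a permutes insert x S" using a by (simp add: cycles_on_def)
      obtain y where ay: "a y = x" using permutes_surj[OF p] by (metis surjD)
      have "y \<noteq> x"
      proof
        assume "y = x"
        then have "a ` {x} = {x}" using ay by simp
        then have "{x} = insert x S" using a unfolding cycles_on_def by blast
        then show False using insert False by auto
      qed
      moreover have "y \<in> insert x S" using permutes_in_image[OF p, of y] ay by simp
      ultimately have yS: "y \<in> S" by simp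
      let ?q = "a \<circ> Transposition.transpose x y"
      have qp: "?q permutes insert x S" using p yS by (intro permutes_compose permutes_swap_id) auto
      have "?q ` (insert x S - {x}) = insert x S - {x}"
        using permutes_image[OF qp] permutes_inj[OF qp] ay by (subst image_set_diff) auto
      then show ?thesis using yS a insert.hyps(2) by auto
    qed
    have un: "cycles_on (insert x S) = (\<Union>y\<in>S. ?B y)" using ex by auto
    have fix_y: "a y = x" if "y \<in> S" "a \<in> ?B y" for a y
    proof -
      let ?q = "a \<circ> Transposition.transpose x y"
      have "a permutes insert x S" using that by (simp add: cycles_on_def)
      then have qp: "?q permutes insert x S" using that by (intro permutes_compose permutes_swap_id) auto
      have "?q ` (insert x S - S) = insert x S - S"
        using permutes_image[OF qp] permutes_inj[OF qp] that by (subst image_set_diff) auto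
      moreover have "insert x S - S = {x}" using insert by auto
      ultimately show ?thesis by simp
    qed
    have "card (cycles_on (insert x S)) = card (\<Union>y\<in>S. ?B y)"
      by (rule arg_cong[OF un])
    also have "\<dots> = (\<Sum>y\<in>S. card (?B y))"
    proof (rule card_UN_disjoint)
      show "\<forall>i\<in>S. \<forall>j\<in>S. i \<noteq> j \<longrightarrow> ?B i \<inter> ?B j = {}"
      proof (intro ballI impI)
        fix i j assume ij: "i \<in> S" "j \<in> S" "i \<noteq> j"
        have "a \<notin> ?B j" if "a \<in> ?B i" for a
        proof
          assume B: "a \<in> ?B j"
          have "a i = a j" by (rule trans[OF fix_y[OF ij(1) that] fix_y[OF ij(2) B, symmetric]])
          moreover have "a permutes insert x S" using that unfolding cycles_on_def by blast
          ultimately show False using ij permutes_inj by (metis injD)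
        qed
        then show "?B i \<inter> ?B j = {}" by blast
      qed
    qed (use insert in \<open>auto simp: finite_cycles_on\<close>)
    also have "\<dots> = (\<Sum>y\<in>S. fact (card S - 1))"
    proof (rule sum.cong)
      fix y assume "y \<in> S"
      from bij_betw_same_card[OF bij[OF this]] show "card (?B y) = fact (card S - 1)"
        using insert.IH by (simp add: card_cartesian_product)
    qed simp
    also have "\<dots> = fact (card S)"
      using False insert.hyps by (cases "card S") auto
    finally have "card (cycles_on (insert x S)) = fact (card (insert x S) - 1)"
      using insert.hyps by simp
    moreover have "sign p = (-1) ^ (card (insert x S) - 1)" if p: "p \<in> cycles_on (insert x S)" for p
    proof -
      from ex[OF p] obtain y where y: "y \<in> S" "p \<in> ?B y" by blast
      then obtain q where q: "q \<in> cycles_on S" "p = q \<circ> Transposition.transpose x y"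
        using bij[OF y(1)] unfolding bij_betw_def by fastforce
      have "permutation q" using q(1) insert.hyps(1) permutes_imp_permutation
        by (auto simp: cycles_on_def)
      then have "sign p = - sign q"
        using q y insert.hyps by (auto simp: sign_compose sign_swap_id permutation_swap_id)
      also have "\<dots> = - ((-1) ^ (card S - 1))" using insert.IH q by simp
      also have "\<dots> = (-1) ^ card S" using False insert.hyps by (cases "card S") auto
      finally show ?thesis using insert.hyps by simp
    qed
    ultimately show ?thesis by blast
  qed
qed

lemma restr_sign_eq_0: "v \<in> I \<Longrightarrow> p v \<notin> I \<Longrightarrow> restr_sign p I = 0"
  unfolding restr_sign_def by (metis imageI)

section \<open>Hook characters\<close>

text \<open>
  \<open>ext_char X k\<close> is the character of the k-th exterior power of the permutation representation of
  \<open>Sym X\<close>, and \<open>hook_char X k\<close> that of the standard representation. With s the sum of the basis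
  vectors and \<open>\<iota>\<close> the contraction by the coordinate sum, \<open>swap_char X k p\<close> is the trace of p
  composed with the off-diagonal part of \<open>s \<and> \<iota>\<close>; the diagonal part is multiplication by k. The
  recursion for it expresses the relation \<open>s \<and> \<iota> + \<iota> (s \<and> _) = n\<close>.
\<close>

definition ext_char :: "'a set \<Rightarrow> nat \<Rightarrow> ('a \<Rightarrow> 'a) \<Rightarrow> int" where
  "ext_char X k p = (\<Sum>I | I \<subseteq> X \<and> card I = k. restr_sign p I)"

definition swap_char :: "'a set \<Rightarrow> nat \<Rightarrow> ('a \<Rightarrow> 'a) \<Rightarrow> int" where
  "swap_char X k p = (\<Sum>I | I \<subseteq> X \<and> card I = k. \<Sum>y\<in>I. \<Sum>x\<in>X - I.
     restr_sign (Transposition.transpose x y \<circ> p) I)"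

primrec hook_char :: "'a set \<Rightarrow> nat \<Rightarrow> ('a \<Rightarrow> 'a) \<Rightarrow> int" where
  "hook_char X 0 p = ext_char X 0 p"
| "hook_char X (Suc k) p = ext_char X (Suc k) p - hook_char X k p"

section \<open>From exterior powers to hook characters\<close>

lemma restr_sign_transpose_insert:
  assumes fin: "finite L" and inj: "inj p" and x: "x \<notin> L" and y: "y \<notin> L"
  shows "restr_sign (Transposition.transpose x y \<circ> p) (insert y L) =
    (if p y = x then restr_sign p L
     else if p y \<in> L then - restr_sign (Transposition.transpose x (p y) \<circ> p) L else 0)"
proof -
  let ?t = "Transposition.transpose x y"
  have inj_t: "inj (Transposition.transpose a b \<circ> q)" if "inj q" for a b and q :: "'a \<Rightarrow> 'a"
    using that by (simp add: inj_compose)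
  consider "p y = x" | "p y \<noteq> x" "p y \<in> L" | "p y \<noteq> x" "p y \<notin> L" by blast
  then show ?thesis
  proof cases
    case 1
    have *: "p v \<noteq> x" if "v \<in> L" for v
      using that 1 y inj by (metis injD)
    have "restr_sign (?t \<circ> p) (insert y L) = restr_sign (?t \<circ> p) L"
      using 1 y inj_t[OF inj] by (intro restr_sign_insert_fixed) auto
    also have "\<dots> = restr_sign p L"
    proof (cases "y \<in> p ` L")
      case True
      then obtain v where v: "v \<in> L" "p v = y" by auto
      then have "restr_sign (?t \<circ> p) L = 0" "restr_sign p L = 0"
        using x y by (auto intro!: restr_sign_eq_0[of v])
      then show ?thesis by simp
    next
      case False
      then show ?thesis using * by (intro restr_sign_cong) (auto simp: transpose_def)
    qed
    finally show ?thesis using 1 by simp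
  next
    case 2
    let ?z = "p y"
    let ?r = "Transposition.transpose y ?z \<circ> (?t \<circ> p)"
    have *: "p v \<noteq> ?z" if "v \<in> L" for v
      using that y inj by (metis injD)
    have zy: "?z \<noteq> y" using 2 y by auto
    have "restr_sign ?r (insert y L) = - restr_sign (?t \<circ> p) (insert y L)"
      using 2 zy fin by (intro restr_sign_transpose_comp) auto
    moreover have "restr_sign ?r (insert y L) = restr_sign ?r L"
      using 2 y zy inj_t[OF inj_t[OF inj]] by (intro restr_sign_insert_fixed) auto
    moreover have "restr_sign ?r L = restr_sign (Transposition.transpose x ?z \<circ> p) L"
    proof (cases "y \<in> p ` L \<and> x \<noteq> y")
      case True
      then obtain v where v: "v \<in> L" "p v = y" by auto
      then have "restr_sign ?r L = 0" "restr_sign (Transposition.transpose x ?z \<circ> p) L = 0"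
        using x y True 2 zy by (auto intro!: restr_sign_eq_0[of v] simp: transpose_def split: if_splits)
      then show ?thesis by simp
    next
      case False
      then show ?thesis using * 2 zy
        by (intro restr_sign_cong) (auto simp: transpose_def)
    qed
    ultimately show ?thesis using 2 by simp
  next
    case 3
    then have "(?t \<circ> p) y \<notin> insert y L"
      using x y by (auto simp: transpose_def)
    then show ?thesis using 3 by (simp add: restr_sign_eq_0[of y])
  qed
qed

lemma sum_restr_sign_transpose_insert:
  assumes fin: "finite X" and p: "p permutes X" and L: "L \<subseteq> X" and x: "x \<in> X - L"
  shows "(\<Sum>y\<in>X - L. restr_sign (Transposition.transpose x y \<circ> p) (insert y L)) =
    restr_sign p L - (\<Sum>z\<in>L. restr_sign (Transposition.transpose x z \<circ> p) L)"
proof -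
  let ?g = "\<lambda>z. restr_sign (Transposition.transpose x z \<circ> p) L"
  have inj: "inj p" using p by (rule permutes_inj)
  have finL: "finite L" using fin L finite_subset by blast
  have "(\<Sum>y\<in>X - L. restr_sign (Transposition.transpose x y \<circ> p) (insert y L)) =
    (\<Sum>y\<in>X - L. (if p y = x then restr_sign p L else 0) - (if p y \<in> L then ?g (p y) else 0))"
    using x by (intro sum.cong refl) (auto simp: restr_sign_transpose_insert[OF finL inj])
  also have "\<dots> = (\<Sum>y\<in>X - L. (if p y = x then restr_sign p L else 0))
      - (\<Sum>y\<in>X - L. if p y \<in> L then ?g (p y) else 0)"
    by (rule sum_subtractf)
  also have "(\<Sum>y\<in>X - L. (if p y = x then restr_sign p L else 0)) = restr_sign p L"
  proof -
    obtain w where w: "p w = x" using permutes_surj[OF p] by (metis surjD)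
    have wX: "w \<in> X" using permutes_in_image[OF p, of w] w x by simp
    have eq: "p y = x \<longleftrightarrow> w = y" for y using w inj by (metis injD)
    \<comment> \<open>The sum runs over points outside \<open>L\<close>, so the preimage
      \<open>w\<close> of \<open>x\<close> may be missing from it; the value to be produced is then
      zero as well.\<close>
    have "restr_sign p L = 0" if "w \<in> L"
      using that w x by (intro restr_sign_eq_0[of w]) auto
    then show ?thesis using wX fin by (simp add: eq)
  qed
  also have "(\<Sum>y\<in>X - L. if p y \<in> L then ?g (p y) else 0)
      = (\<Sum>z\<in>p ` (X - L). if z \<in> L then ?g z else 0)"
    by (subst sum.reindex) (use inj in \<open>auto intro: inj_on_subset\<close>)
  also have "\<dots> = (\<Sum>z\<in>p ` (X - L) \<inter> L. ?g z)"
    using fin by (subst sum.inter_restrict) auto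
  also have "\<dots> = (\<Sum>z\<in>L. ?g z)"
  proof (rule sum.mono_neutral_left)
    \<comment> \<open>A point \<open>z\<close> of \<open>L\<close> not reached from outside
      \<open>L\<close> has its preimage in \<open>L\<close>, and the composite sends that preimage
      to \<open>x\<close>, which lies outside \<open>L\<close>.\<close>
    show "\<forall>z\<in>L - p ` (X - L) \<inter> L. ?g z = 0"
    proof
      fix z assume z: "z \<in> L - p ` (X - L) \<inter> L"
      obtain v where v: "p v = z" using permutes_surj[OF p] by (metis surjD)
      then have "v \<in> X" using permutes_in_image[OF p, of v] z L by auto
      then have "v \<in> L" using v z by blast
      then show "?g z = 0" using v x by (intro restr_sign_eq_0[of v]) auto
    qed
  qed (use finL in auto)
  finally show ?thesis .
qed

lemma sum_subsets_Suc:
  fixes f :: "'a set \<Rightarrow> 'a \<Rightarrow> 'b::comm_monoid_add"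
  assumes fin: "finite X"
  shows "(\<Sum>I | I \<subseteq> X \<and> card I = Suc k. \<Sum>y\<in>I. f I y) =
    (\<Sum>L | L \<subseteq> X \<and> card L = k. \<Sum>y\<in>X - L. f (insert y L) y)"
proof -
  have f: "finite I" if "I \<subseteq> X" for I using that fin finite_subset by blast
  have "(\<Sum>I | I \<subseteq> X \<and> card I = Suc k. \<Sum>y\<in>I. f I y) =
    (\<Sum>(I, y)\<in>(SIGMA I:{I. I \<subseteq> X \<and> card I = Suc k}. I). f I y)"
    using fin f by (subst sum.Sigma) auto
  also have "\<dots> = (\<Sum>(L, y)\<in>(SIGMA L:{L. L \<subseteq> X \<and> card L = k}. X - L). f (insert y L) y)"
    by (rule sum.reindex_bij_witness[where i = "\<lambda>(L, y). (insert y L, y)" and j = "\<lambda>(I, y). (I - {y}, y)"])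
      (auto simp: insert_absorb card_insert_if f)
  also have "\<dots> = (\<Sum>L | L \<subseteq> X \<and> card L = k. \<Sum>y\<in>X - L. f (insert y L) y)"
    using fin f by (subst sum.Sigma) auto
  finally show ?thesis .
qed

text \<open>The left side is the trace of \<open>p\<close> composed with
  \<open>s \<and> \<iota>\<close> in degree \<open>k + 1\<close>. Since \<open>p\<close> commutes
  with both factors, cyclicity of the trace turns it into the trace of \<open>p\<close> composed
  with \<open>\<iota> (s \<and> _)\<close> in degree \<open>k\<close>. Combinatorially, this is the
  passage from a set with a marked point \<open>y\<close> to the set without it.\<close>

lemma swap_char_recursion:
  assumes fin: "finite X" and p: "p permutes X" and k: "k \<le> card X"
  shows "swap_char X (Suc k) p + int (Suc k) * ext_char X (Suc k) p =
    int (card X - k) * ext_char X k p - swap_char X k p"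
proof -
  let ?r = "\<lambda>x y I. restr_sign (Transposition.transpose x y \<circ> p) I"
  let ?S = "\<lambda>k. {I. I \<subseteq> X \<and> card I = k}"
  have f: "finite I" if "I \<subseteq> X" for I using that fin finite_subset by blast
  have "swap_char X (Suc k) p + int (Suc k) * ext_char X (Suc k) p =
    (\<Sum>I\<in>?S (Suc k). (\<Sum>y\<in>I. \<Sum>x\<in>X - I. ?r x y I) + (\<Sum>y\<in>I. restr_sign p I))"
    unfolding swap_char_def ext_char_def sum_distrib_left sum.distrib[symmetric]
    by (intro sum.cong) auto
  \<comment> \<open>The extra multiple of \<open>ext_char\<close> supplies the terms with
    \<open>x = y\<close>, one for each point of \<open>I\<close>.\<close>
  also have "\<dots> = (\<Sum>I\<in>?S (Suc k). \<Sum>y\<in>I. \<Sum>x\<in>X - (I - {y}). ?r x y I)"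
    unfolding sum.distrib[symmetric]
  proof (intro sum.cong refl)
    fix I y assume I: "I \<in> ?S (Suc k)" and y: "y \<in> I"
    have "X - (I - {y}) = insert y (X - I)" using I y by auto
    moreover have "?r y y I = restr_sign p I" by simp
    ultimately show "(\<Sum>x\<in>X - I. ?r x y I) + restr_sign p I = (\<Sum>x\<in>X - (I - {y}). ?r x y I)"
      using fin y by simp
  qed
  also have "\<dots> = (\<Sum>L\<in>?S k. \<Sum>y\<in>X - L. \<Sum>x\<in>X - (insert y L - {y}). ?r x y (insert y L))"
    by (rule sum_subsets_Suc[OF fin])
  also have "\<dots> = (\<Sum>L\<in>?S k. \<Sum>y\<in>X - L. \<Sum>x\<in>X - L. ?r x y (insert y L))"
    by (intro sum.cong refl) auto
  also have "\<dots> = (\<Sum>L\<in>?S k. \<Sum>x\<in>X - L. \<Sum>y\<in>X - L. ?r x y (insert y L))"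
    by (intro sum.cong refl sum.swap)
  also have "\<dots> = (\<Sum>L\<in>?S k. \<Sum>x\<in>X - L. restr_sign p L - (\<Sum>z\<in>L. ?r x z L))"
    by (intro sum.cong refl sum_restr_sign_transpose_insert[OF fin p]) auto
  also have "\<dots> = (\<Sum>L\<in>?S k. int (card X - k) * restr_sign p L - (\<Sum>z\<in>L. \<Sum>x\<in>X - L. ?r x z L))"
  proof (intro sum.cong refl)
    fix L assume L: "L \<in> ?S k"
    then have "card (X - L) = card X - k" using f[of L] by (simp add: card_Diff_subset)
    then show "(\<Sum>x\<in>X - L. restr_sign p L - (\<Sum>z\<in>L. ?r x z L)) =
      int (card X - k) * restr_sign p L - (\<Sum>z\<in>L. \<Sum>x\<in>X - L. ?r x z L)"
      by (simp add: sum_subtractf sum.swap[of _ L])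
  qed
  also have "\<dots> = int (card X - k) * ext_char X k p - swap_char X k p"
    unfolding swap_char_def ext_char_def by (simp add: sum_subtractf sum_distrib_left)
  finally show ?thesis .
qed

lemma subsets_card_0: "finite X \<Longrightarrow> {I. I \<subseteq> X \<and> card I = 0} = {{}}"
  by (auto dest: finite_subset)

lemma ext_char_0 [simp]: "finite X \<Longrightarrow> ext_char X 0 p = 1"
  unfolding ext_char_def by (simp only: subsets_card_0) simp

lemma swap_char_0 [simp]: "finite X \<Longrightarrow> swap_char X 0 p = 0"
  unfolding swap_char_def by (simp only: subsets_card_0) simp

text \<open>The operator \<open>s \<and> \<iota>\<close> squares to n times itself, so dividing it
  by n gives a projection. Its image in degree \<open>k + 1\<close> is a copy of the k-th exterior
  power of the standard representation, and the identity compares traces.\<close>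

lemma card_times_hook_char:
  assumes fin: "finite X" and p: "p permutes X"
  shows "k \<le> card X \<Longrightarrow>
    int (card X) * hook_char X k p = swap_char X (Suc k) p + int (Suc k) * ext_char X (Suc k) p"
proof (induction k)
  case 0
  then show ?case using swap_char_recursion[OF fin p, of 0] fin by simp
next
  case (Suc k)
  have "int (card X) * hook_char X (Suc k) p =
    int (card X) * ext_char X (Suc k) p - (swap_char X (Suc k) p + int (Suc k) * ext_char X (Suc k) p)"
    using Suc by (simp add: algebra_simps)
  also have "\<dots> = int (card X - Suc k) * ext_char X (Suc k) p - swap_char X (Suc k) p"
    using Suc.prems by (simp add: algebra_simps)
  finally show ?case using swap_char_recursion[OF fin p, of "Suc k"] Suc.prems by simp
qed

text \<open>Exchanging a point of \<open>I\<close> with a point outside never stabilises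
  \<open>I\<close>, so \<open>swap_char\<close> vanishes at the identity and only the count of
  subsets of size \<open>k + 1\<close> remains.\<close>

lemma hook_char_id:
  assumes fin: "finite X" and k: "k < card X"
  shows "hook_char X k id = int ((card X - 1) choose k)"
proof -
  have "swap_char X (Suc k) id = 0"
    unfolding swap_char_def
  proof (intro sum.neutral ballI)
    fix I y x assume "I \<in> {I. I \<subseteq> X \<and> card I = Suc k}" "y \<in> I" "x \<in> X - I"
    then show "restr_sign (Transposition.transpose x y \<circ> id) I = 0"
      by (intro restr_sign_eq_0[of y]) auto
  qed
  moreover have "ext_char X (Suc k) id = int (card X choose Suc k)"
    unfolding ext_char_def by (simp add: n_subsets[OF fin])
  ultimately have "int (card X) * hook_char X k id = int (Suc k * (card X choose Suc k))"
    using card_times_hook_char[OF fin permutes_id, of k] k by (simp add: distrib_right)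
  also have "\<dots> = int (card X) * int ((card X - 1) choose k)"
    using k Suc_times_binomial_eq[of "card X - 1" k] by (simp add: algebra_simps flip: of_nat_mult)
  finally show ?thesis using k by simp
qed

section \<open>Summation over left translates by full cycles\<close>

text \<open>A summand is nonzero only if the composite stabilises \<open>I\<close>; it is then a
  full cycle on \<open>I\<close> times one on the complement. The two factorials count these pairs,
  and the power of -1 is the sign of the cycle on \<open>I\<close>.\<close>

lemma sum_cycles_on_restr_sign_transpose:
  assumes fin: "finite X" and I: "I \<subseteq> X" and y: "y \<in> I" and x: "x \<in> X - I"
  shows "(\<Sum>a\<in>cycles_on X. restr_sign (a \<circ> Transposition.transpose x y) I) =
    (-1) ^ (card I - 1) * fact (card I - 1) * fact (card X - card I - 1)"
proof -
  let ?t = "Transposition.transpose x y"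
  let ?J = "X - I"
  have finI: "finite I" and finJ: "finite ?J" using I fin finite_subset by auto
  have X: "I \<union> ?J = X" using I by auto
  have disj: "I \<inter> ?J = {}" by auto
  note bij = bij_betw_cycles_on_join[OF finI finJ disj y x, unfolded X]
  have "(\<Sum>a\<in>cycles_on X. restr_sign (a \<circ> ?t) I) =
    (\<Sum>a\<in>{a \<in> cycles_on X. (a \<circ> ?t) ` I = I}. restr_sign (a \<circ> ?t) I)"
    using finite_cycles_on[OF fin] by (intro sum.mono_neutral_right) (auto simp: restr_sign_def)
  also have "\<dots> = (\<Sum>(q, r)\<in>cycles_on I \<times> cycles_on ?J. restr_sign (q \<circ> r \<circ> ?t \<circ> ?t) I)"
    by (subst sum.reindex_bij_betw[OF bij, symmetric]) (simp add: case_prod_unfold)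
  also have "\<dots> = (\<Sum>(q, r)\<in>cycles_on I \<times> cycles_on ?J. (-1) ^ (card I - 1))"
  proof (intro sum.cong refl, clarify)
    fix q r assume qr: "q \<in> cycles_on I" "r \<in> cycles_on ?J"
    have "q \<circ> r \<circ> ?t \<circ> ?t = q \<circ> r" by (simp add: comp_assoc)
    moreover have "restr_sign (q \<circ> r) I = restr_sign q I"
    proof (rule restr_sign_cong)
      fix v assume "v \<in> I"
      moreover have "r permutes ?J" using qr by (simp add: cycles_on_def)
      ultimately have "r v = v" by (meson DiffD2 permutes_not_in)
      then show "(q \<circ> r) v = q v" by simp
    qed
    moreover have "restr_sign q I = sign q"
      using qr(1) by (intro restr_sign_permutes) (simp add: cycles_on_def)
    moreover have "sign q = (-1) ^ (card I - 1)"
      using card_and_sign_cycles_on[OF finI] qr(1) by simp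
    ultimately show "restr_sign (q \<circ> r \<circ> ?t \<circ> ?t) I = (-1) ^ (card I - 1)" by simp
  qed
  also have "\<dots> = int (card (cycles_on I) * card (cycles_on ?J)) * (-1) ^ (card I - 1)"
    by (simp add: card_cartesian_product)
  also have "\<dots> = (-1) ^ (card I - 1) * fact (card I - 1) * fact (card X - card I - 1)"
    using card_and_sign_cycles_on[OF finI] card_and_sign_cycles_on[OF finJ] I finI
    by (simp add: card_Diff_subset)
  finally show ?thesis .
qed

lemma cycles_on_conj_transpose:
  assumes a: "a \<in> cycles_on X" and xy: "x \<in> X" "y \<in> X"
  shows "Transposition.transpose x y \<circ> a \<circ> Transposition.transpose x y \<in> cycles_on X"
proof -
  let ?t = "Transposition.transpose x y"
  have tt: "?t ` ?t ` A = A" for A by (simp add: image_comp)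
  have "?t permutes X" using xy by (rule permutes_swap_id)
  moreover have "a permutes X" using a by (simp add: cycles_on_def)
  ultimately have "?t \<circ> a \<circ> ?t permutes X" by (intro permutes_compose)
  moreover have "T = {} \<or> T = X" if T: "T \<subseteq> X" "(?t \<circ> a \<circ> ?t) ` T = T" for T
  proof -
    have "?t ` X = X" using xy by simp
    then have sub: "?t ` T \<subseteq> X" using T(1) by (metis image_mono)
    have "?t ` a ` ?t ` T = T" using T(2) by (simp add: image_comp comp_assoc)
    then have "a ` (?t ` T) = ?t ` T" by (metis tt)
    then have "?t ` T = {} \<or> ?t ` T = X" using a sub by (auto simp: cycles_on_def)
    then show ?thesis using \<open>?t ` X = X\<close> by (metis image_empty tt)
  qed
  ultimately show ?thesis by (auto simp: cycles_on_def)
qed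

lemma transpose_comp_inj:
  assumes "inj u"
  shows "Transposition.transpose (u a) (u b) \<circ> u = u \<circ> Transposition.transpose a b"
  using assms by (auto simp: fun_eq_iff transpose_def inj_def)

text \<open>If u moves two points out of I, conjugation by their transposition is a sign-reversing
  involution.\<close>

lemma sum_cycles_on_restr_sign_eq_0:
  assumes fin: "finite X" and u: "u permutes X" and I: "I \<subseteq> X"
    and pq: "v \<in> I" "w \<in> I" "u v \<noteq> u w" "u v \<notin> I" "u w \<notin> I"
  shows "(\<Sum>a\<in>cycles_on X. restr_sign (a \<circ> u) I) = 0"
proof -
  let ?t = "Transposition.transpose (u v) (u w)"
  let ?s = "Transposition.transpose v w"
  let ?c = "\<lambda>a. ?t \<circ> a \<circ> ?t"
  have finI: "finite I" using I fin finite_subset by auto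
  have mem: "u v \<in> X" "u w \<in> X" using pq I permutes_in_image[OF u] by auto
  have vw: "v \<noteq> w" using pq(3) by auto
  have cc: "?c (?c a) = a" for a by (simp add: fun_eq_iff)
  have neg: "restr_sign (?c a \<circ> u) I = - restr_sign (a \<circ> u) I" for a
  proof -
    \<comment> \<open>Moved across \<open>u\<close>, the inner \<open>?t\<close> becomes a
      transposition of two points of \<open>I\<close>, which flips the sign, while the outer
      \<open>?t\<close> fixes \<open>I\<close> pointwise.\<close>
    have "?c a \<circ> u = (?t \<circ> (a \<circ> u)) \<circ> ?s"
      using transpose_comp_inj[OF permutes_inj[OF u], of v w] by (metis comp_assoc)
    moreover have "restr_sign ((?t \<circ> (a \<circ> u)) \<circ> ?s) I = - restr_sign (?t \<circ> (a \<circ> u)) I"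
      using pq finI vw by (subst restr_sign_comp) (auto simp: restr_sign_transpose)
    moreover have "restr_sign (?t \<circ> (a \<circ> u)) I = restr_sign (a \<circ> u) I"
    proof (cases "(a \<circ> u) ` I = I")
      case True
      have "?t z = z" if "z \<in> I" for z using that pq by (auto simp: transpose_def)
      then show ?thesis using True by (intro restr_sign_cong) auto
    next
      case False
      have "?t ` I = I" using pq by simp
      then have "(?t \<circ> (a \<circ> u)) ` I \<noteq> I" using False by (simp only: transpose_comp_image_eq_iff) simp
      then show ?thesis using False by (simp add: restr_sign_def)
    qed
    ultimately show ?thesis by simp
  qed
  have "(\<Sum>a\<in>cycles_on X. restr_sign (a \<circ> u) I) = (\<Sum>a\<in>cycles_on X. restr_sign (?c a \<circ> u) I)"
    by (rule sum.reindex_bij_witness[where i = ?c and j = ?c])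
      (use cycles_on_conj_transpose[OF _ mem] cc in auto)
  also have "\<dots> = - (\<Sum>a\<in>cycles_on X. restr_sign (a \<circ> u) I)"
    by (simp only: neg sum_negf)
  finally show ?thesis by simp
qed

text \<open>The cases are the number of points that \<open>u\<close> moves out of \<open>I\<close>.
  For none, both sides vanish, a full cycle having no proper nonempty invariant set. For one,
  \<open>u\<close> agrees with a unique exchange \<open>x\<close>, \<open>y\<close> up to a map
  stabilising \<open>I\<close>, and signs multiply. For more, the involution applies.\<close>

lemma sum_cycles_on_restr_sign:
  assumes fin: "finite X" and u: "u permutes X" and I: "I \<subseteq> X" "I \<noteq> {}" "I \<noteq> X"
  shows "(\<Sum>a\<in>cycles_on X. restr_sign (a \<circ> u) I) =
    (-1) ^ (card I - 1) * fact (card I - 1) * fact (card X - card I - 1) *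
    (\<Sum>y\<in>I. \<Sum>x\<in>X - I. restr_sign (Transposition.transpose x y \<circ> u) I)"
proof (cases "\<exists>y\<in>I. \<exists>x\<in>X - I. u ` I = Transposition.transpose x y ` I")
  case True
  then obtain x y where y: "y \<in> I" and x: "x \<in> X - I" and ux: "u ` I = Transposition.transpose x y ` I"
    by blast
  let ?v = "Transposition.transpose x y \<circ> u"
  have finI: "finite I" using I fin finite_subset by auto
  have vI: "?v ` I = I" using ux by (simp only: transpose_comp_image_eq_iff)
  have "(\<Sum>a\<in>cycles_on X. restr_sign (a \<circ> u) I) =
    (\<Sum>a\<in>cycles_on X. restr_sign (a \<circ> Transposition.transpose x y) I * restr_sign ?v I)"
  proof (intro sum.cong refl)
    fix a :: "'a \<Rightarrow> 'a"
    have "a \<circ> u = (a \<circ> Transposition.transpose x y) \<circ> ?v" by (simp add: fun_eq_iff)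
    then show "restr_sign (a \<circ> u) I = restr_sign (a \<circ> Transposition.transpose x y) I * restr_sign ?v I"
      using restr_sign_comp[OF finI vI] by metis
  qed
  also have "\<dots> = (-1) ^ (card I - 1) * fact (card I - 1) * fact (card X - card I - 1) * restr_sign ?v I"
    using sum_cycles_on_restr_sign_transpose[OF fin I(1) y x] by (simp add: sum_distrib_right[symmetric])
  also have "restr_sign ?v I = (\<Sum>y\<in>I. \<Sum>x\<in>X - I. restr_sign (Transposition.transpose x y \<circ> u) I)"
  proof -
    have z: "restr_sign (Transposition.transpose x' y' \<circ> u) I = 0"
      if "y' \<in> I" "x' \<in> X - I" "(x', y') \<noteq> (x, y)" for x' y'
    proof -
      have "Transposition.transpose x y ` I = insert x (I - {y})"
        "Transposition.transpose x' y' ` I = insert x' (I - {y'})"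
        using that x y by (simp_all add: transpose_image_swap)
      then have "u ` I \<noteq> Transposition.transpose x' y' ` I" using that x y ux by auto
      then show ?thesis unfolding restr_sign_def transpose_comp_image_eq_iff by simp
    qed
    have "(\<Sum>y\<in>I. \<Sum>x\<in>X - I. restr_sign (Transposition.transpose x y \<circ> u) I) =
      (\<Sum>(y', x')\<in>I \<times> (X - I). restr_sign (Transposition.transpose x' y' \<circ> u) I)"
      by (simp add: sum.cartesian_product)
    also have "\<dots> = (\<Sum>(y', x')\<in>{(y, x)}. restr_sign (Transposition.transpose x' y' \<circ> u) I)"
      using x y z fin finI by (intro sum.mono_neutral_right) auto
    finally show ?thesis by simp
  qed
  finally show ?thesis .
next
  case False
  have finI: "finite I" using I fin finite_subset by auto
  have cardu: "card (u ` I) = card I" using permutes_inj[OF u] by (simp add: card_image inj_on_subset)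
  have "restr_sign (Transposition.transpose x y \<circ> u) I = 0" if "y \<in> I" "x \<in> X - I" for x y
    using that False unfolding restr_sign_def transpose_comp_image_eq_iff by auto
  moreover have "(\<Sum>a\<in>cycles_on X. restr_sign (a \<circ> u) I) = 0"
  proof (cases "u ` I = I")
    case True
    have "restr_sign (a \<circ> u) I = 0" if "a \<in> cycles_on X" for a
    proof -
      have "(a \<circ> u) ` I = a ` I" using True by (metis image_comp)
      moreover have "a ` I \<noteq> I" using that I by (auto simp: cycles_on_def)
      ultimately show ?thesis by (simp add: restr_sign_def)
    qed
    then show ?thesis by simp
  next
    case uI: False
    have "\<not> u ` I \<subseteq> I" using uI cardu finI by (metis card_subset_eq)
    then obtain v where v: "v \<in> I" "u v \<notin> I" by blast
    have "\<exists>w\<in>I. u w \<notin> I \<and> u w \<noteq> u v"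
    proof (rule ccontr)
      assume "\<not> ?thesis"
      \<comment> \<open>If \<open>u v\<close> were the only image outside \<open>I\<close>, the
        image of \<open>I\<close> would arise from \<open>I\<close> by exchanging a single point for
        \<open>u v\<close>, contrary to the case assumption.\<close>
      then have sub: "u ` I - {u v} \<subseteq> I" by blast
      have c: "card (u ` I - {u v}) = card I - 1" using v cardu finI by simp
      have "card (I - (u ` I - {u v})) = 1"
        using c sub finI v card_gt_0_iff[of I] by (subst card_Diff_subset) auto
      then obtain y where y: "I - (u ` I - {u v}) = {y}" by (metis card_1_singletonE)
      then have "u ` I - {u v} = I - {y}" "y \<in> I" using sub by auto
      then have "u ` I = insert (u v) (I - {y})" using v by auto
      moreover have "u v \<in> X - I" using v I permutes_in_image[OF u] by auto
      ultimately show False using False \<open>y \<in> I\<close> transpose_image_swap[of y I "u v"] by blast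
    qed
    then obtain w where "w \<in> I" "u w \<notin> I" "u v \<noteq> u w" by metis
    then show ?thesis using v I by (intro sum_cycles_on_restr_sign_eq_0[OF fin u, of I v w])
  qed
  ultimately show ?thesis by simp
qed

lemma sum_cycles_on_ext_char:
  assumes fin: "finite X" and u: "u permutes X" and k: "0 < k" "k < card X"
  shows "(\<Sum>a\<in>cycles_on X. ext_char X k (a \<circ> u)) =
    (-1) ^ (k - 1) * fact (k - 1) * fact (card X - k - 1) * swap_char X k u"
proof -
  have "(\<Sum>a\<in>cycles_on X. ext_char X k (a \<circ> u)) =
    (\<Sum>I | I \<subseteq> X \<and> card I = k. \<Sum>a\<in>cycles_on X. restr_sign (a \<circ> u) I)"
    unfolding ext_char_def by (rule sum.swap)
  also have "\<dots> = (\<Sum>I | I \<subseteq> X \<and> card I = k.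
     (-1) ^ (k - 1) * fact (k - 1) * fact (card X - k - 1) *
     (\<Sum>y\<in>I. \<Sum>x\<in>X - I. restr_sign (Transposition.transpose x y \<circ> u) I))"
  proof (intro sum.cong refl)
    fix I assume "I \<in> {I. I \<subseteq> X \<and> card I = k}"
    then have I: "I \<subseteq> X" "card I = k" by auto
    then have "I \<noteq> {}" "I \<noteq> X" using k by auto
    from sum_cycles_on_restr_sign[OF fin u I(1) this]
    show "(\<Sum>a\<in>cycles_on X. restr_sign (a \<circ> u) I) =
      (-1) ^ (k - 1) * fact (k - 1) * fact (card X - k - 1) *
      (\<Sum>y\<in>I. \<Sum>x\<in>X - I. restr_sign (Transposition.transpose x y \<circ> u) I)"
      unfolding I(2) .
  qed
  finally show ?thesis unfolding swap_char_def by (simp add: sum_distrib_left)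
qed

definition hook_eigenvalue :: "nat \<Rightarrow> nat \<Rightarrow> int" where
  "hook_eigenvalue n k = (-1) ^ k * fact k * fact (n - 1 - k)"

text \<open>Expanding \<open>swap_char X (Suc k)\<close> in the hook characters of index
  \<open>k\<close> and \<open>Suc k\<close> produces exactly the coefficients
  \<open>\<lambda>\<^sub>k\<close> and \<open>\<lambda>\<^sub>k\<^sub>+\<^sub>1\<close>. The first
  term cancels against the induction hypothesis.\<close>

lemma sum_cycles_on_hook_char:
  assumes fin: "finite X" and u: "u permutes X"
  shows "k < card X \<Longrightarrow> (\<Sum>a\<in>cycles_on X. hook_char X k (a \<circ> u)) =
    hook_eigenvalue (card X) k * hook_char X k u"
proof (induction k)
  case 0
  then show ?case using fin card_and_sign_cycles_on[OF fin] by (simp add: hook_eigenvalue_def)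
next
  case (Suc k)
  let ?n = "card X"
  let ?c = "(-1) ^ k * fact k * fact (?n - Suc k - 1) :: int"
  have "swap_char X (Suc k) u = int ?n * hook_char X k u - int (Suc k) * ext_char X (Suc k) u"
    using card_times_hook_char[OF fin u, of k] Suc.prems by simp
  also have "\<dots> = int (?n - Suc k) * hook_char X k u - int (Suc k) * hook_char X (Suc k) u"
    using Suc.prems by (simp add: algebra_simps)
  finally have sw: "swap_char X (Suc k) u = \<dots>" .
  have "fact (?n - 1 - k) = (int (?n - Suc k) * fact (?n - Suc k - 1) :: int)"
    using Suc.prems by (subst fact_reduce) auto
  then have e1: "?c * int (?n - Suc k) = hook_eigenvalue ?n k"
    by (simp add: hook_eigenvalue_def)
  have "?n - 1 - Suc k = ?n - Suc k - 1" by simp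
  then have e2: "?c * int (Suc k) = - hook_eigenvalue ?n (Suc k)"
    by (simp add: hook_eigenvalue_def algebra_simps)
  have "(\<Sum>a\<in>cycles_on X. hook_char X (Suc k) (a \<circ> u)) =
    (\<Sum>a\<in>cycles_on X. ext_char X (Suc k) (a \<circ> u)) - (\<Sum>a\<in>cycles_on X. hook_char X k (a \<circ> u))"
    by (simp add: sum_subtractf)
  also have "\<dots> = ?c * swap_char X (Suc k) u - hook_eigenvalue ?n k * hook_char X k u"
    using sum_cycles_on_ext_char[OF fin u, of "Suc k"] Suc.prems
    by (subst Suc.IH) simp_all
  also have "?c * swap_char X (Suc k) u =
    (?c * int (?n - Suc k)) * hook_char X k u - (?c * int (Suc k)) * hook_char X (Suc k) u"
    unfolding sw by (simp add: right_diff_distrib)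
  also have "\<dots> = hook_eigenvalue ?n k * hook_char X k u
      + hook_eigenvalue ?n (Suc k) * hook_char X (Suc k) u"
    unfolding e1 e2 by simp
  finally show ?case by simp
qed

text \<open>If p is not a full cycle, adding or removing a fixed cycle of p that avoids x is a sign-reversing
  involution on the invariant sets.\<close>

lemma alternating_sum_invariant_sets:
  assumes fin: "finite X" and p: "p permutes X" and x: "x \<in> X"
  shows "(\<Sum>I\<in>Pow (X - {x}). (-1) ^ card I * restr_sign p I) = (if p \<in> cycles_on X then 1 else 0)"
proof (cases "p \<in> cycles_on X")
  case True
  have "(\<Sum>I\<in>Pow (X - {x}). (-1) ^ card I * restr_sign p I) =
    (\<Sum>I\<in>{{}}. (-1) ^ card I * restr_sign p I)"
  proof (rule sum.mono_neutral_right)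
    show "\<forall>I\<in>Pow (X - {x}) - {{}}. (-1) ^ card I * restr_sign p I = 0"
    proof
      fix I assume "I \<in> Pow (X - {x}) - {{}}"
      then have "p ` I \<noteq> I" using True x by (auto simp: cycles_on_def)
      then show "(-1) ^ card I * restr_sign p I = 0" by (simp add: restr_sign_def)
    qed
  qed (use fin in auto)
  then show ?thesis using True by simp
next
  case False
  have inj: "inj p" using p by (rule permutes_inj)
  let ?Inv = "\<lambda>T. T \<subseteq> X - {x} \<and> p ` T = T"
  have "\<exists>T. ?Inv T \<and> T \<noteq> {}"
  proof -
    obtain T where T: "T \<subseteq> X" "p ` T = T" "T \<noteq> {}" "T \<noteq> X"
      using False p by (auto simp: cycles_on_def)
    have "p ` (X - T) = X - T" using inj T permutes_image[OF p] by (simp add: image_set_diff)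
    then show ?thesis using T
      by (cases "x \<in> T") (blast intro: exI[of _ "X - T"], blast)
  qed
  \<comment> \<open>A smallest nonempty invariant set avoiding \<open>x\<close> is a single cycle of
    \<open>p\<close>, so its weight is -1 whatever its length.\<close>
  then obtain Q where Q: "?Inv Q" "Q \<noteq> {}"
    and min: "\<And>T. ?Inv T \<Longrightarrow> T \<noteq> {} \<Longrightarrow> card Q \<le> card T"
    using ex_has_least_nat[of "\<lambda>T. ?Inv T \<and> T \<noteq> {}" _ card] by metis
  have finQ: "finite Q" using Q fin finite_subset by blast
  have minQ: "T = {} \<or> T = Q" if "T \<subseteq> Q" "p ` T = T" for T
    using that Q min[of T] finQ card_seteq[of Q T] by blast
  have "perm_restrict p Q \<in> cycles_on Q"
  proof -
    have "perm_restrict p Q ` T = p ` T" if "T \<subseteq> Q" for T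
      using that by (force simp: perm_restrict_def image_iff)
    then show ?thesis unfolding cycles_on_def
      using perm_restrict_permutes[OF finQ] Q minQ by auto
  qed
  then have "restr_sign p Q = (-1) ^ (card Q - 1)"
    using card_and_sign_cycles_on[OF finQ] Q by (simp add: restr_sign_def)
  moreover have "card Q > 0" using Q finQ by (simp add: card_gt_0_iff)
  ultimately have signQ: "(-1) ^ card Q * restr_sign p Q = -1"
    by (cases "card Q") (auto simp flip: power_mult_distrib)
  let ?w = "\<lambda>I. (-1) ^ card I * restr_sign p I"
  define P where "P = {I. ?Inv I \<and> I \<inter> Q = {}}"
  have finP: "finite P" unfolding P_def using fin by (auto intro: finite_subset[of _ "Pow (X - {x})"])
  have split: "{I. ?Inv I} = P \<union> (\<lambda>I. I \<union> Q) ` P"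
  proof (intro equalityI subsetI)
    fix I assume I: "I \<in> {I. ?Inv I}"
    then have "p ` (I \<inter> Q) = I \<inter> Q" using Q by (simp add: image_Int[OF inj])
    then consider "I \<inter> Q = {}" | "Q \<subseteq> I" using minQ[of "I \<inter> Q"] by blast
    then show "I \<in> P \<union> (\<lambda>I. I \<union> Q) ` P"
    proof cases
      case 1
      then show ?thesis using I by (simp add: P_def)
    next
      case 2
      have "p ` (I - Q) = I - Q" using I Q by (simp add: image_set_diff[OF inj])
      then have "I - Q \<in> P" using I by (auto simp: P_def)
      moreover have "I = (I - Q) \<union> Q" using 2 by blast
      ultimately show ?thesis by blast
    qed
  next
    fix I assume "I \<in> P \<union> (\<lambda>I. I \<union> Q) ` P"
    then show "I \<in> {I. ?Inv I}" using Q by (auto simp: P_def image_Un)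
  qed
  have "(\<Sum>I\<in>Pow (X - {x}). ?w I) = (\<Sum>I\<in>{I. ?Inv I}. ?w I)"
    using fin by (intro sum.mono_neutral_right) (auto simp: restr_sign_def)
  also have "\<dots> = (\<Sum>I\<in>P. ?w I) + (\<Sum>I\<in>(\<lambda>I. I \<union> Q) ` P. ?w I)"
    unfolding split using finP Q by (intro sum.union_disjoint) (auto simp: P_def)
  also have "(\<Sum>I\<in>(\<lambda>I. I \<union> Q) ` P. ?w I) = (\<Sum>I\<in>P. ?w (I \<union> Q))"
  proof (subst sum.reindex)
    show "inj_on (\<lambda>I. I \<union> Q) P" by (auto simp: P_def inj_on_def)
  qed simp
  also have "\<dots> = (\<Sum>I\<in>P. - ?w I)"
  proof (intro sum.cong refl)
    fix I assume I: "I \<in> P"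
    then have finI: "finite I" using fin by (auto simp: P_def intro: finite_subset)
    have "?w (I \<union> Q) = ?w I * ((-1) ^ card Q * restr_sign p Q)"
      using I Q finI finQ by (simp add: P_def restr_sign_union card_Un_disjoint power_add)
    then show "?w (I \<union> Q) = - ?w I" unfolding signQ by simp
  qed
  also have "(\<Sum>I\<in>P. ?w I) + \<dots> = 0" by (simp add: sum_negf)
  finally show ?thesis using False by simp
qed

text \<open>Unfolding the recursion gives each subset \<open>I\<close> the weight n minus its
  cardinality, which counts the points \<open>x\<close> outside \<open>I\<close>. Exchanging the
  sums leaves, for every \<open>x\<close>, the alternating sum over invariant sets avoiding
  \<open>x\<close>.\<close>

lemma sum_hook_char:
  assumes fin: "finite X" and p: "p permutes X"
  shows "(\<Sum>k<card X. (-1) ^ k * hook_char X k p) = (if p \<in> cycles_on X then int (card X) else 0)"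
proof -
  let ?n = "card X"
  let ?w = "\<lambda>I. (-1) ^ card I * restr_sign p I"
  have h: "(-1) ^ k * hook_char X k p = (\<Sum>j\<le>k. (-1) ^ j * ext_char X j p)" for k
    by (induction k) (auto simp: algebra_simps)
  have "(\<Sum>k<m. (-1) ^ k * hook_char X k p) = (\<Sum>j<m. (int m - int j) * ((-1) ^ j * ext_char X j p))" for m
  proof (induction m)
    case (Suc m)
    have "(\<Sum>j<Suc m. (int (Suc m) - int j) * ((-1) ^ j * ext_char X j p)) =
      (\<Sum>j<Suc m. (int m - int j) * ((-1) ^ j * ext_char X j p)) + (\<Sum>j<Suc m. (-1) ^ j * ext_char X j p)"
      by (simp add: algebra_simps sum.distrib[symmetric])
    then show ?case using Suc by (simp add: h lessThan_Suc_atMost[symmetric])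
  qed simp
  then have "(\<Sum>k<?n. (-1) ^ k * hook_char X k p) =
    (\<Sum>j<?n. (int ?n - int j) * ((-1) ^ j * ext_char X j p))" .
  \<comment> \<open>The added term \<open>j = ?n\<close> has weight zero; it lets the sum range over
    all subsets.\<close>
  also have "\<dots> = (\<Sum>j\<le>?n. (int ?n - int j) * ((-1) ^ j * ext_char X j p))"
    by (simp add: lessThan_Suc_atMost[symmetric])
  also have "\<dots> = (\<Sum>j\<le>?n. \<Sum>I\<in>{I \<in> Pow X. card I = j}. (int ?n - int (card I)) * ?w I)"
    unfolding ext_char_def sum_distrib_left
    by (intro sum.cong) auto
  also have "\<dots> = (\<Sum>I\<in>Pow X. (int ?n - int (card I)) * ?w I)"
    using fin by (intro sum.group) (auto intro: card_mono)
  also have "\<dots> = (\<Sum>I\<in>Pow X. \<Sum>x\<in>X. if x \<notin> I then ?w I else 0)"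
  proof (intro sum.cong refl)
    fix I assume I: "I \<in> Pow X"
    then have "finite I" using fin finite_subset by auto
    then have "int (card (X - I)) = int ?n - int (card I)"
      using I fin by (simp add: card_Diff_subset card_mono)
    moreover have "(\<Sum>x\<in>X. if x \<notin> I then ?w I else 0) = (\<Sum>x\<in>X - I. ?w I)"
      unfolding set_diff_eq by (rule sum.inter_filter[OF fin, symmetric])
    ultimately show "(int ?n - int (card I)) * ?w I = (\<Sum>x\<in>X. if x \<notin> I then ?w I else 0)" by simp
  qed
  also have "\<dots> = (\<Sum>x\<in>X. \<Sum>I\<in>Pow X. if x \<notin> I then ?w I else 0)" by (rule sum.swap)
  also have "\<dots> = (\<Sum>x\<in>X. \<Sum>I\<in>Pow (X - {x}). ?w I)"
  proof (rule sum.cong[OF refl])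
    fix x
    have "(\<Sum>I\<in>Pow X. if x \<notin> I then ?w I else 0) = (\<Sum>I\<in>{I \<in> Pow X. x \<notin> I}. ?w I)"
      using fin by (simp only: sum.inter_filter[symmetric] finite_Pow_iff)
    moreover have "{I \<in> Pow X. x \<notin> I} = Pow (X - {x})" by auto
    ultimately show "(\<Sum>I\<in>Pow X. if x \<notin> I then ?w I else 0) = (\<Sum>I\<in>Pow (X - {x}). ?w I)" by simp
  qed
  also have "\<dots> = (\<Sum>x\<in>X. if p \<in> cycles_on X then 1 else 0)"
    by (intro sum.cong refl alternating_sum_invariant_sets[OF fin p])
  finally show ?thesis by simp
qed

section \<open>Characteristic polynomials and power traces\<close>

lemma sign_map_permutation:
  assumes "p permutes A" "finite A" and inj: "inj_on f A"
  shows "sign (map_permutation A f p) = sign p"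
  using assms(1,2)
proof (induction rule: permutes_induct)
  case id
  show ?case by (simp only: map_permutation_id'[OF inj] sign_id)
next
  case (swap a b p)
  have "map_permutation A f p permutes f ` A"
    using swap inj by (intro map_permutation_permutes) (auto simp: bij_betw_def)
  then have "permutation (map_permutation A f p)" "permutation p"
    using assms(2) swap permutes_imp_permutation by blast+
  moreover have "f a \<noteq> f b" using swap inj by (auto dest: inj_onD)
  moreover have "map_permutation A f (Transposition.transpose a b \<circ> p) =
      Transposition.transpose (f a) (f b) \<circ> map_permutation A f p"
    using swap inj by (simp add: map_permutation_compose' map_permutation_transpose)
  ultimately have "sign (map_permutation A f (Transposition.transpose a b \<circ> p)) =
      sign (Transposition.transpose a b \<circ> p)"
    using swap(3) swap.IH by (simp add: sign_compose sign_swap_id permutation_swap_id)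
  then show ?case by (simp only: comp_def)
qed

text \<open>Relabelling the vertices by \<open>b\<close> transports permutations with their signs,
  so the two Leibniz expansions agree term by term. This opens the way to Schur
  decomposition.\<close>

lemma graph_charpoly_eq_char_poly:
  assumes b: "bij_betw b {0..<N} V"
  shows "graph_charpoly V E = char_poly (mat N N (\<lambda>(i, j). if E (b i) (b j) then 1 else 0))"
proof -
  let ?M = "mat N N (\<lambda>(i, j). if E (b i) (b j) then 1 else 0) :: complex mat"
  let ?f = "\<lambda>v w. (if w = v then [:0, 1:] else 0) - (if E v w then 1 else 0) :: complex poly"
  let ?m = "map_permutation {0..<N} b"
  have inj: "inj_on b {0..<N}" and img: "b ` {0..<N} = V" using b by (auto simp: bij_betw_def)
  have bij: "bij_betw ?m {p. p permutes {0..<N}} {p. p permutes V}"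
  proof (rule bij_betw_byWitness[where f' = "map_permutation V (inv_into {0..<N} b)"])
    have inv: "bij_betw (inv_into {0..<N} b) V {0..<N}" by (rule bij_betw_inv_into[OF b])
    show "\<forall>p\<in>{p. p permutes {0..<N}}. map_permutation V (inv_into {0..<N} b) (?m p) = p"
      using inj img by (auto intro!: map_permutation_compose_inv simp: bij_betw_def)
    show "\<forall>p\<in>{p. p permutes V}. ?m (map_permutation V (inv_into {0..<N} b) p) = p"
      using inv img by (auto intro!: map_permutation_compose_inv simp: bij_betw_def f_inv_into_f)
    show "?m ` {p. p permutes {0..<N}} \<subseteq> {p. p permutes V}"
      using map_permutation_permutes[OF b] by auto
    show "map_permutation V (inv_into {0..<N} b) ` {p. p permutes V} \<subseteq> {p. p permutes {0..<N}}"
      using map_permutation_permutes[OF inv] by auto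
  qed
  have "graph_charpoly V E = (\<Sum>p | p permutes V. of_int (sign p) * (\<Prod>v\<in>V. ?f v (p v)))"
    unfolding graph_charpoly_def ..
  also have "\<dots> = (\<Sum>p | p permutes {0..<N}. of_int (sign (?m p)) * (\<Prod>v\<in>V. ?f v (?m p v)))"
    by (rule sum.reindex_bij_betw[OF bij, symmetric])
  also have "\<dots> = (\<Sum>p | p permutes {0..<N}. of_int (sign p) *
      (\<Prod>i = 0..<N. char_poly_matrix ?M $$ (i, p i)))"
  proof (rule sum.cong[OF refl])
    fix p assume "p \<in> {p. p permutes {0..<N}}"
    then have p: "p permutes {0..<N}" by simp
    have "(\<Prod>v\<in>V. ?f v (?m p v)) = (\<Prod>i = 0..<N. ?f (b i) (?m p (b i)))"
      by (rule prod.reindex_bij_betw[OF b, symmetric])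
    also have "\<dots> = (\<Prod>i = 0..<N. char_poly_matrix ?M $$ (i, p i))"
    proof (rule prod.cong[OF refl])
      fix i assume i: "i \<in> {0..<N}"
      then have pi: "p i \<in> {0..<N}" using permutes_in_image[OF p] by simp
      have "?m p (b i) = b (p i)" using inj i by (rule map_permutation_apply)
      moreover have "b (p i) = b i \<longleftrightarrow> p i = i" using inj i pi by (auto dest: inj_onD)
      ultimately show "?f (b i) (?m p (b i)) = char_poly_matrix ?M $$ (i, p i)"
        using i pi by (auto simp: char_poly_matrix_def one_pCons)
    qed
    finally show "of_int (sign (?m p)) * (\<Prod>v\<in>V. ?f v (?m p v)) =
      of_int (sign p) * (\<Prod>i = 0..<N. char_poly_matrix ?M $$ (i, p i))"
      using sign_map_permutation[OF p _ inj] by simp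
  qed
  also have "\<dots> = char_poly ?M"
    unfolding char_poly_def by (subst det_def'[of _ N]) auto
  finally show ?thesis .
qed

section \<open>Traces of matrix powers\<close>

definition mat_trace :: "'a :: comm_monoid_add mat \<Rightarrow> 'a" where
  "mat_trace A = (\<Sum>i<dim_row A. A $$ (i, i))"

lemma mat_trace_mult_comm:
  fixes A B :: "'a :: comm_semiring_0 mat"
  assumes "A \<in> carrier_mat n m" "B \<in> carrier_mat m n"
  shows "mat_trace (A * B) = mat_trace (B * A)"
proof -
  have "mat_trace (A * B) = (\<Sum>i<n. \<Sum>j = 0..<m. A $$ (i, j) * B $$ (j, i))"
    using assms by (simp add: mat_trace_def scalar_prod_def)
  also have "\<dots> = (\<Sum>j = 0..<m. \<Sum>i<n. A $$ (i, j) * B $$ (j, i))"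
    by (rule sum.swap)
  also have "\<dots> = mat_trace (B * A)"
    using assms by (simp add: mat_trace_def scalar_prod_def mult.commute atLeast0LessThan)
  finally show ?thesis .
qed

lemma upper_triangular_pow:
  fixes B :: "'a :: comm_semiring_1 mat"
  assumes B: "B \<in> carrier_mat n n" "upper_triangular B"
  shows "(\<forall>i<n. \<forall>j<i. (B ^\<^sub>m k) $$ (i, j) = 0) \<and> (\<forall>i<n. (B ^\<^sub>m k) $$ (i, i) = B $$ (i, i) ^ k)"
proof (induction k)
  case 0
  then show ?case using B by auto
next
  case (Suc k)
  have entry: "(B ^\<^sub>m Suc k) $$ (i, j) = (\<Sum>l = 0..<n. (B ^\<^sub>m k) $$ (i, l) * B $$ (l, j))"
    if "i < n" "j < n" for i j
    using B that by (simp add: scalar_prod_def)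
  have ut: "B $$ (l, j) = 0" if "j < l" "l < n" for l j
    using B that by (auto simp: upper_triangular_def)
  have "(B ^\<^sub>m Suc k) $$ (i, j) = 0" if "i < n" "j < i" for i j
  proof -
    have "(B ^\<^sub>m k) $$ (i, l) * B $$ (l, j) = 0" if "l < n" for l
      using Suc ut \<open>i < n\<close> \<open>j < i\<close> that by (cases "l < i") auto
    then show ?thesis using that by (simp only: entry) (simp add: sum.neutral)
  qed
  moreover have "(B ^\<^sub>m Suc k) $$ (i, i) = B $$ (i, i) ^ Suc k" if i: "i < n" for i
  proof -
    have "(\<Sum>l = 0..<n. (B ^\<^sub>m k) $$ (i, l) * B $$ (l, i)) =
      (\<Sum>l\<in>{i}. (B ^\<^sub>m k) $$ (i, l) * B $$ (l, i))"
    proof (rule sum.mono_neutral_right)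
      show "\<forall>l\<in>{0..<n} - {i}. (B ^\<^sub>m k) $$ (i, l) * B $$ (l, i) = 0"
      proof
        fix l assume "l \<in> {0..<n} - {i}"
        then consider "l < i" | "i < l" "l < n" by fastforce
        then show "(B ^\<^sub>m k) $$ (i, l) * B $$ (l, i) = 0" using Suc ut i by cases auto
      qed
    qed (use i in auto)
    then show ?thesis using i Suc by (simp only: entry) (simp add: mult.commute)
  qed
  ultimately show ?case by blast
qed

text \<open>Over the complex numbers the matrix is similar to a triangular one carrying the
  eigenvalues on its diagonal with multiplicity. Powers of a triangular matrix have the powers of
  these entries on the diagonal, and similarity preserves the trace.\<close>

lemma trace_pow_eq_sum_eigenvalues:
  fixes A :: "complex mat"
  assumes A: "A \<in> carrier_mat n n"
  shows "size (proots (char_poly A)) = n"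
    and "mat_trace (A ^\<^sub>m m) = (\<Sum>e\<in>#proots (char_poly A). e ^ m)"
proof -
  obtain es where es: "char_poly A = (\<Prod>a\<leftarrow>es. [:- a, 1:])" "length es = n"
    using char_poly_factorized[OF A] by blast
  have roots: "proots (\<Prod>a\<leftarrow>as. [:- a, 1:]) = mset as" for as :: "complex list"
  proof (induction as)
    case (Cons a as)
    have "(\<Prod>a\<leftarrow>as. [:- a, 1:]) \<noteq> 0" by auto
    then show ?case using Cons by (simp add: proots_mult del: mult_pCons_left)
  qed simp
  show "size (proots (char_poly A)) = n" using es by (simp add: roots)
  obtain B P Q where "schur_decomposition A es = (B, P, Q)" by (metis prod_cases3)
  from schur_decomposition[OF A es(1) this]
  have sim: "similar_mat_wit A B P Q" and ut: "upper_triangular B" and diag: "diag_mat B = es" by auto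
  note sD = similar_mat_witD2[OF A sim]
  have "A ^\<^sub>m m = P * B ^\<^sub>m m * Q" by (rule similar_mat_wit_pow_id[OF sim])
  then have "mat_trace (A ^\<^sub>m m) = mat_trace (P * (B ^\<^sub>m m * Q))"
    using sD by (subst assoc_mult_mat[symmetric, of _ n n _ n _ n]) auto
  also have "\<dots> = mat_trace (B ^\<^sub>m m * Q * P)"
    using sD by (intro mat_trace_mult_comm[of _ n n]) auto
  also have "B ^\<^sub>m m * Q * P = B ^\<^sub>m m"
    using sD by (subst assoc_mult_mat[of _ n n _ n _ n]) auto
  also have "mat_trace (B ^\<^sub>m m) = (\<Sum>i<n. B $$ (i, i) ^ m)"
    using upper_triangular_pow[OF _ ut, of n m] sD by (simp add: mat_trace_def)
  also have "\<dots> = (\<Sum>e\<leftarrow>es. e ^ m)"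
    using sD unfolding diag[symmetric] diag_mat_def
    by (simp add: sum_list_sum_nth atLeast0LessThan)
  also have "\<dots> = (\<Sum>e\<in>#proots (char_poly A). e ^ m)"
    by (simp add: es(1) roots flip: sum_mset_sum_list)
  finally show "mat_trace (A ^\<^sub>m m) = (\<Sum>e\<in>#proots (char_poly A). e ^ m)" .
qed

section \<open>Spectral sums from power sums\<close>

lemma poly_interpolation_exists:
  fixes g :: "'a :: field \<Rightarrow> 'a"
  assumes "finite W"
  shows "\<exists>p. \<forall>w\<in>W. poly p w = g w"
  using assms
proof (induction W)
  case (insert z W)
  then obtain p where p: "\<forall>w\<in>W. poly p w = g w" by blast
  define d where "d = (\<Prod>w\<in>W. [:- w, 1:])"
  have d0: "poly d w = 0" if "w \<in> W" for w
    using that insert.hyps by (auto simp: d_def poly_prod)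
  have dz: "poly d z \<noteq> 0" using insert.hyps by (auto simp: d_def poly_prod)
  have "\<forall>w\<in>insert z W. poly (p + Polynomial.smult ((g z - poly p z) / poly d z) d) w = g w"
    using p d0 dz by auto
  then show ?case by blast
qed simp

text \<open>Interpolating g by a polynomial without constant term reduces the claim to power sums.\<close>

lemma sum_mset_eq_of_power_sums:
  fixes E :: "'a :: field multiset" and c ev :: "'b \<Rightarrow> 'a"
  assumes fin: "finite K"
    and pow: "\<And>m. (\<Sum>e\<in>#E. e ^ Suc m) = (\<Sum>k\<in>K. c k * ev k ^ Suc m)"
    and g: "g 0 = 0"
  shows "(\<Sum>e\<in>#E. g e) = (\<Sum>k\<in>K. c k * g (ev k))"
proof -
  \<comment> \<open>The node 0 forces the constant coefficient to be \<open>g 0 = 0\<close>, as the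
    power sum with exponent 0 is not at hand.\<close>
  have "finite (insert 0 (set_mset E \<union> ev ` K))" using fin by simp
  from poly_interpolation_exists[OF this, of g] obtain p
    where p0: "poly p 0 = g 0" and pE: "\<And>e. e \<in># E \<Longrightarrow> poly p e = g e"
      and pK: "\<And>k. k \<in> K \<Longrightarrow> poly p (ev k) = g (ev k)" by auto
  obtain a q where pq: "p = pCons a q" by (cases p)
  have a: "a = 0" using p0 g pq by simp
  have eval: "poly p z = (\<Sum>i\<le>degree q. coeff q i * z ^ Suc i)" for z
  proof -
    have "poly p z = z * poly q z" by (simp add: pq a)
    then show ?thesis
      by (simp add: poly_altdef[of q] sum_distrib_left mult.assoc mult.left_commute)
  qed
  have "(\<Sum>e\<in>#E. g e) = (\<Sum>e\<in>#E. \<Sum>i\<le>degree q. coeff q i * e ^ Suc i)"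
    using pE by (intro arg_cong[where f = sum_mset] image_mset_cong) (simp add: eval flip: pE)
  also have "\<dots> = (\<Sum>i\<le>degree q. \<Sum>e\<in>#E. coeff q i * e ^ Suc i)"
    by (induction E) (simp_all add: sum.distrib)
  also have "\<dots> = (\<Sum>i\<le>degree q. coeff q i * (\<Sum>e\<in>#E. e ^ Suc i))"
    by (simp only: sum_mset_distrib_left)
  also have "\<dots> = (\<Sum>i\<le>degree q. \<Sum>k\<in>K. c k * (coeff q i * ev k ^ Suc i))"
    unfolding pow by (simp add: sum_distrib_left mult.left_commute)
  also have "\<dots> = (\<Sum>k\<in>K. c k * poly p (ev k))"
    unfolding eval sum_distrib_left by (rule sum.swap)
  also have "\<dots> = (\<Sum>k\<in>K. c k * g (ev k))" using pK by simp
  finally show ?thesis .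
qed

section \<open>The Cayley graph of the full cycles\<close>

text \<open>Powers of a list cycle carry any entry to any other, so an invariant set with one entry
  contains all. Conversely, the orbit of 1 is invariant, hence everything, and listing it exhibits
  the cycle.\<close>

lemma full_cycles_eq_cycles_on:
  assumes "0 < n"
  shows "full_cycles n = cycles_on {1..n}"
proof (intro equalityI subsetI)
  fix p assume "p \<in> full_cycles n"
  then obtain cs where cs: "distinct cs" "set cs = {1..n}" and p: "p = cycle_of_list cs"
    by (auto simp: full_cycles_def)
  have "T = {1..n}" if T: "T \<subseteq> {1..n}" "p ` T = T" "T \<noteq> {}" for T
  proof -
    have powT: "(p ^^ k) v \<in> T" if "v \<in> T" for k v
      using that T(2) by (induction k) auto
    obtain i where i: "i < length cs" "cs ! i \<in> T"
      using T cs by (metis all_not_in_conv in_set_conv_nth subset_iff)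
    have "cs ! j \<in> T" if j: "j < length cs" for j
    proof -
      \<comment> \<open>Adding the length keeps the rotation distance from position \<open>i\<close>
        to \<open>j\<close> a natural number when \<open>j < i\<close>.\<close>
      let ?k = "length cs + j - i"
      have "(p ^^ ?k) (cs ! i) = rotate ?k cs ! i"
        using cyclic_rotation[OF cs(1), of ?k] i(1) p by (metis nth_map)
      also have "\<dots> = cs ! ((?k + i) mod length cs)" using i(1) by (simp add: nth_rotate)
      also have "?k + i = j + length cs" using i(1) by simp
      finally show ?thesis using powT[OF i(2), of ?k] j by simp
    qed
    then show ?thesis using T cs by (metis in_set_conv_nth subsetI subset_antisym)
  qed
  moreover have "p permutes {1..n}" using cycle_permutes[of cs] cs p by simp
  ultimately show "p \<in> cycles_on {1..n}" by (auto simp: cycles_on_def)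
next
  fix p assume p: "p \<in> cycles_on {1..n}"
  then have perm: "p permutes {1..n}" by (simp add: cycles_on_def)
  then have per: "permutation p" using permutes_imp_permutation by blast
  let ?cs = "support p 1"
  have set: "set ?cs = range (\<lambda>i. (p ^^ i) 1)" by (rule support_set[OF per])
  have "(p ^^ i) 1 \<in> {1..n}" for i
    using permutes_in_image[OF permutes_funpow[OF perm, of i], of 1] assms by simp
  then have sub: "set ?cs \<subseteq> {1..n}" unfolding set by blast
  have "p ` set ?cs \<subseteq> set ?cs"
  proof
    fix z assume "z \<in> p ` set ?cs"
    then obtain i where "z = p ((p ^^ i) 1)" unfolding set by blast
    then have "z = (p ^^ Suc i) 1" by simp
    then show "z \<in> set ?cs" unfolding set by blast
  qed
  moreover have "card (p ` set ?cs) = card (set ?cs)"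
    using permutes_inj[OF perm] by (simp add: card_image inj_on_subset)
  ultimately have "p ` set ?cs = set ?cs" by (metis List.finite_set card_subset_eq)
  moreover have "set ?cs \<noteq> {}" unfolding set by blast
  ultimately have cs: "set ?cs = {1..n}" using p sub unfolding cycles_on_def by blast
  have "p = cycle_of_list ?cs"
  proof
    fix v
    show "p v = cycle_of_list ?cs v"
    proof (cases "v \<in> set ?cs")
      case True
      then show ?thesis by (rule cycle_restrict[OF per])
    next
      case False
      then have "cycle_of_list ?cs v = v" by (rule id_outside_supp)
      moreover have "p v = v" using perm False cs by (metis permutes_not_in)
      ultimately show ?thesis by simp
    qed
  qed
  then show "p \<in> full_cycles n"
    using cs cycle_of_permutation[OF per, of 1] unfolding full_cycles_def by blast
qed

lemma inv_mem_cycles_on: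
  assumes a: "a \<in> cycles_on X"
  shows "inv_into UNIV a \<in> cycles_on X"
proof -
  have p: "a permutes X" using a by (simp add: cycles_on_def)
  have "T = {} \<or> T = X" if T: "T \<subseteq> X" "inv_into UNIV a ` T = T" for T
  proof -
    have "a ` T = a ` inv_into UNIV a ` T" using T(2) by simp
    also have "\<dots> = T" using permutes_surj[OF p] by (simp add: image_f_inv_f)
    finally show ?thesis using a T(1) by (auto simp: cycles_on_def)
  qed
  then show ?thesis using permutes_inv[OF p] by (auto simp: cycles_on_def)
qed

lemma cayley_adj_cycles_on_iff:
  assumes "u permutes X"
  shows "cayley_adj (cycles_on X) u v \<longleftrightarrow> v \<circ> inv_into UNIV u \<in> cycles_on X"
proof
  assume "cayley_adj (cycles_on X) u v"
  then obtain a where "a \<in> cycles_on X" "v = a \<circ> u" by (auto simp: cayley_adj_def)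
  then show "v \<circ> inv_into UNIV u \<in> cycles_on X"
    using permutes_inv_o(1)[OF assms] by (simp add: comp_assoc)
next
  assume "v \<circ> inv_into UNIV u \<in> cycles_on X"
  moreover have "v = (v \<circ> inv_into UNIV u) \<circ> u"
    using permutes_inv_o(2)[OF assms] by (simp add: comp_assoc)
  ultimately show "cayley_adj (cycles_on X) u v" unfolding cayley_adj_def by blast
qed

text \<open>Full cycles are closed under inversion, so \<open>v = a \<circ> w\<close> can be solved
  for \<open>w\<close> as a translate of \<open>v\<close> by a full cycle.\<close>

lemma sum_cayley_neighbours:
  fixes f :: "('a \<Rightarrow> 'a) \<Rightarrow> 'b :: comm_monoid_add"
  assumes fin: "finite X" and v: "v permutes X"
  shows "(\<Sum>w | w permutes X. if cayley_adj (cycles_on X) w v then f w else 0) =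
    (\<Sum>a\<in>cycles_on X. f (a \<circ> v))"
proof -
  have perm: "a permutes X" if "a \<in> cycles_on X" for a using that by (simp add: cycles_on_def)
  have "{w \<in> {w. w permutes X}. cayley_adj (cycles_on X) w v} = (\<lambda>a. a \<circ> v) ` cycles_on X"
  proof (intro equalityI subsetI)
    fix w assume "w \<in> {w \<in> {w. w permutes X}. cayley_adj (cycles_on X) w v}"
    then obtain a where a: "a \<in> cycles_on X" "v = a \<circ> w" by (auto simp: cayley_adj_def)
    then have "w = inv_into UNIV a \<circ> v"
      using permutes_inv_o(2)[OF perm[OF a(1)]] by (simp add: comp_assoc[symmetric])
    then show "w \<in> (\<lambda>a. a \<circ> v) ` cycles_on X" using inv_mem_cycles_on[OF a(1)] by blast
  next
    fix w assume "w \<in> (\<lambda>a. a \<circ> v) ` cycles_on X"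
    then obtain a where a: "a \<in> cycles_on X" "w = a \<circ> v" by blast
    then have "v = inv_into UNIV a \<circ> w"
      using permutes_inv_o(2)[OF perm[OF a(1)]] by (simp add: comp_assoc[symmetric])
    then have "cayley_adj (cycles_on X) w v"
      unfolding cayley_adj_def using inv_mem_cycles_on[OF a(1)] by blast
    moreover have "w permutes X" using a v perm by (auto intro: permutes_compose)
    ultimately show "w \<in> {w \<in> {w. w permutes X}. cayley_adj (cycles_on X) w v}" by simp
  qed
  moreover have "inj_on (\<lambda>a. a \<circ> v) (cycles_on X)"
  proof (rule inj_onI)
    fix a b :: "'a \<Rightarrow> 'a" assume "a \<circ> v = b \<circ> v"
    then have "a \<circ> (v \<circ> inv_into UNIV v) = b \<circ> (v \<circ> inv_into UNIV v)"
      by (metis comp_assoc)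
    then show "a = b" using permutes_inv_o(1)[OF v] by simp
  qed
  ultimately show ?thesis
    using finite_permutations[OF fin]
    by (simp add: sum.inter_filter[symmetric] sum.reindex)
qed

text \<open>The base case expands the indicator of the full cycles in hook characters and yields no
  eigenvalue, so the exponent lags one behind the matrix power. Each further factor \<open>A\<close>
  sums over left translates and contributes one eigenvalue. The factor \<open>card X\<close> avoids
  division.\<close>

lemma cayley_matrix_pow:
  fixes X :: "'a set"
  assumes fin: "finite X" and b: "bij_betw b {0..<N} {p. p permutes X}"
  defines "A \<equiv> mat N N (\<lambda>(i, j). if cayley_adj (cycles_on X) (b i) (b j) then 1 else 0) :: complex mat"
  assumes i: "i < N"
  shows "j < N \<Longrightarrow> of_nat (card X) * (A ^\<^sub>m Suc m) $$ (i, j) = (\<Sum>k<card X. (-1) ^ k *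
    of_int (hook_eigenvalue (card X) k) ^ m * of_int (hook_char X k (b j \<circ> inv_into UNIV (b i))))"
proof (induction m arbitrary: j)
  case 0
  have bp: "b l permutes X" if "l < N" for l using that b by (auto simp: bij_betw_def)
  have "b j \<circ> inv_into UNIV (b i) permutes X"
    using bp[OF 0] bp[OF i] by (intro permutes_compose permutes_inv)
  from sum_hook_char[OF fin this]
  have "of_int (\<Sum>k<card X. (-1) ^ k * hook_char X k (b j \<circ> inv_into UNIV (b i))) =
    (of_int (if cayley_adj (cycles_on X) (b i) (b j) then int (card X) else 0) :: complex)"
    unfolding cayley_adj_cycles_on_iff[OF bp[OF i]] by presburger
  then show ?case using 0 i by (simp add: A_def comp_def)
next
  case (Suc m)
  let ?n = "card X"
  let ?ui = "inv_into UNIV (b i)"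
  let ?E = "cayley_adj (cycles_on X)"
  let ?c = "\<lambda>k. (-1) ^ k * of_int (hook_eigenvalue ?n k) ^ m :: complex"
  have bp: "b l permutes X" if "l < N" for l using that b by (auto simp: bij_betw_def)
  have A: "A \<in> carrier_mat N N" by (simp add: A_def)
  have pu: "b j \<circ> ?ui permutes X"
    using bp[OF Suc.prems] bp[OF i] by (intro permutes_compose permutes_inv)
  have "(A ^\<^sub>m Suc (Suc m)) $$ (i, j) = (\<Sum>l = 0..<N. (A ^\<^sub>m Suc m) $$ (i, l) * A $$ (l, j))"
    using A i Suc.prems by (subst pow_mat.simps(2)) (simp add: scalar_prod_def del: pow_mat.simps)
  then have "of_nat ?n * (A ^\<^sub>m Suc (Suc m)) $$ (i, j) =
    (\<Sum>l = 0..<N. (of_nat ?n * (A ^\<^sub>m Suc m) $$ (i, l)) * A $$ (l, j))"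
    by (simp only: sum_distrib_left mult.assoc)
  also have "\<dots> = (\<Sum>l = 0..<N. if ?E (b l) (b j) then
      (\<Sum>k<?n. ?c k * of_int (hook_char X k (b l \<circ> ?ui))) else 0)"
  proof (rule sum.cong[OF refl])
    fix l assume "l \<in> {0..<N}"
    then have l: "l < N" by simp
    have "A $$ (l, j) = (if ?E (b l) (b j) then 1 else 0)" using l Suc.prems by (simp add: A_def)
    then show "(of_nat ?n * (A ^\<^sub>m Suc m) $$ (i, l)) * A $$ (l, j) = (if ?E (b l) (b j) then
      (\<Sum>k<?n. ?c k * of_int (hook_char X k (b l \<circ> ?ui))) else 0)"
      unfolding Suc.IH[OF l] by simp
  qed
  also have "\<dots> = (\<Sum>w | w permutes X. if ?E w (b j) then
      (\<Sum>k<?n. ?c k * of_int (hook_char X k (w \<circ> ?ui))) else 0)"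
    by (rule sum.reindex_bij_betw[OF b])
  also have "\<dots> = (\<Sum>a\<in>cycles_on X. \<Sum>k<?n. ?c k * of_int (hook_char X k (a \<circ> b j \<circ> ?ui)))"
    by (rule sum_cayley_neighbours[OF fin bp[OF Suc.prems]])
  also have "\<dots> = (\<Sum>k<?n. \<Sum>a\<in>cycles_on X. ?c k * of_int (hook_char X k (a \<circ> b j \<circ> ?ui)))"
    by (rule sum.swap)
  also have "\<dots> = (\<Sum>k<?n. ?c k * of_int (\<Sum>a\<in>cycles_on X. hook_char X k (a \<circ> (b j \<circ> ?ui))))"
    by (simp only: of_int_sum sum_distrib_left comp_assoc)
  also have "\<dots> = (\<Sum>k<?n. ?c k * of_int (hook_eigenvalue ?n k * hook_char X k (b j \<circ> ?ui)))"
    by (intro sum.cong refl) (simp add: sum_cycles_on_hook_char[OF fin pu])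
  also have "\<dots> = (\<Sum>k<?n. (-1) ^ k * of_int (hook_eigenvalue ?n k) ^ Suc m *
      of_int (hook_char X k (b j \<circ> ?ui)))"
    by (simp add: mult_ac)
  finally show ?case .
qed

text \<open>Eigenvalue times degree is class size times character value. In the trace this supplies
  the missing eigenvalue and the second binomial factor; in the energy it removes one binomial
  factor.\<close>

lemma hook_eigenvalue_times_binomial:
  assumes "k < n"
  shows "hook_eigenvalue n k * int ((n - 1) choose k) = (-1) ^ k * fact (n - 1)"
proof -
  have "fact k * fact (n - 1 - k) * ((n - 1) choose k) = (fact (n - 1) :: nat)"
    using assms by (intro binomial_fact_lemma) auto
  then have "int (fact k * fact (n - 1 - k) * ((n - 1) choose k)) = fact (n - 1)"
    by (metis of_nat_fact)
  then show ?thesis by (simp add: hook_eigenvalue_def mult.assoc)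
qed

lemma power_sums_cayley_cycles:
  fixes X :: "'a set"
  assumes fin: "finite X" and X: "X \<noteq> {}"
  defines "E \<equiv> graph_eigenvalues {p. p permutes X} (cayley_adj (cycles_on X))"
  shows "size E = fact (card X)"
    and "(\<Sum>e\<in>#E. e ^ Suc m) = (\<Sum>k<card X.
      of_nat (((card X - 1) choose k)\<^sup>2) * of_int (hook_eigenvalue (card X) k) ^ Suc m)"
proof -
  let ?n = "card X" and ?N = "card {p. p permutes X}"
  have N: "?N = fact ?n" using fin by (simp add: card_permutations)
  have n: "?n > 0" using fin X by (simp add: card_gt_0_iff)
  obtain b where b: "bij_betw b {0..<?N} {p. p permutes X}"
    using ex_bij_betw_nat_finite finite_permutations[OF fin] by blast
  define A :: "complex mat" where
    "A = mat ?N ?N (\<lambda>(i, j). if cayley_adj (cycles_on X) (b i) (b j) then 1 else 0)"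
  have A: "A \<in> carrier_mat ?N ?N" by (simp add: A_def)
  have E: "E = proots (char_poly A)"
    by (simp add: E_def graph_eigenvalues_def graph_charpoly_eq_char_poly[OF b] A_def)
  show "size E = fact (card X)"
    using trace_pow_eq_sum_eigenvalues(1)[OF A] by (simp add: E N)
  let ?l = "\<lambda>k. of_int (hook_eigenvalue ?n k) :: complex"
  have bp: "b l permutes X" if "l < ?N" for l using that b by (auto simp: bij_betw_def)
  have "of_nat ?n * (\<Sum>e\<in>#E. e ^ Suc m) = of_nat ?n * mat_trace (A ^\<^sub>m Suc m)"
    unfolding E trace_pow_eq_sum_eigenvalues(2)[OF A] ..
  also have "\<dots> = (\<Sum>i<?N. of_nat ?n * (A ^\<^sub>m Suc m) $$ (i, i))"
    using A by (simp add: mat_trace_def sum_distrib_left del: pow_mat.simps)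
  also have "\<dots> = (\<Sum>i<?N. \<Sum>k<?n. (-1) ^ k * ?l k ^ m * of_nat ((?n - 1) choose k))"
  proof (rule sum.cong[OF refl])
    fix i assume "i \<in> {..<?N}"
    then have i: "i < ?N" by simp
    show "of_nat ?n * (A ^\<^sub>m Suc m) $$ (i, i) =
      (\<Sum>k<?n. (-1) ^ k * ?l k ^ m * of_nat ((?n - 1) choose k))"
      unfolding A_def cayley_matrix_pow[OF fin b i i] permutes_inv_o(1)[OF bp[OF i]]
      by (intro sum.cong refl) (simp add: hook_char_id[OF fin])
  qed
  \<comment> \<open>All n! diagonal entries agree; splitting n! into n times (n-1)! frees the factor
    n to be cancelled.\<close>
  also have "\<dots> = of_nat ?n * (\<Sum>k<?n. ?l k ^ m * of_nat ((?n - 1) choose k) * of_int ((-1) ^ k * fact (?n - 1)))"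
  proof -
    have "(fact ?n :: complex) = of_nat ?n * fact (?n - 1)" using n by (simp add: fact_reduce)
    then show ?thesis by (simp add: N sum_distrib_left mult_ac)
  qed
  also have "\<dots> = of_nat ?n * (\<Sum>k<?n. ?l k ^ m * of_nat ((?n - 1) choose k) *
      of_int (hook_eigenvalue ?n k * int ((?n - 1) choose k)))"
    by (intro arg_cong[where f = "\<lambda>x. of_nat ?n * x"] sum.cong refl)
      (simp only: hook_eigenvalue_times_binomial lessThan_iff)
  also have "\<dots> = of_nat ?n * (\<Sum>k<?n. of_nat (((?n - 1) choose k)\<^sup>2) * ?l k ^ Suc m)"
    by (simp add: power2_eq_square mult_ac)
  finally show "(\<Sum>e\<in>#E. e ^ Suc m) = (\<Sum>k<?n. of_nat (((?n - 1) choose k)\<^sup>2) * ?l k ^ Suc m)"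
    by (rule mult_left_cancel[THEN iffD1, rotated]) (use n in simp)
qed

text \<open>The bound 4 of the theorem enters here: both sides are 8 at 4, and the inequality fails
  at 3.\<close>

lemma two_power_ge_double:
  assumes "4 \<le> n"
  shows "2 * n \<le> 2 ^ (n - 1)"
  using assms
proof (induction n rule: dec_induct)
  case (step n)
  then have "2 ^ (Suc n - 1) = 2 * (2 ^ (n - 1) :: nat)" by (cases n) auto
  then show ?case using step by simp
qed simp

theorem theorem1p1:
  fixes n :: nat
  assumes "n \<ge> 4"
  shows "graph_integral (Sym n) (cayley_adj (full_cycles n))
       \<and> hyperenergetic (Sym n) (cayley_adj (full_cycles n))
       \<and> graph_energy (Sym n) (cayley_adj (full_cycles n)) = 2 ^ (n - 1) * fact (n - 1)
       \<and> int (graph_nullity (Sym n) (cayley_adj (full_cycles n)))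
           = int (fact n) - int ((2 * n - 2) choose (n - 1))"
proof -
  define E where "E = graph_eigenvalues (Sym n) (cayley_adj (full_cycles n))"
  let ?c = "\<lambda>k. (n - 1) choose k"
  let ?l = "\<lambda>k. of_int (hook_eigenvalue n k) :: complex"
  have n: "n > 0" using assms by simp
  have ne: "{1..n} \<noteq> {}" using n by auto
  have E': "E = graph_eigenvalues {p. p permutes {1..n}} (cayley_adj (cycles_on {1..n}))"
    by (simp only: E_def Sym_def full_cycles_eq_cycles_on[OF n])
  have size: "size E = fact n"
    using power_sums_cayley_cycles(1)[OF _ ne] by (simp add: E')
  have sum_E: "(\<Sum>e\<in>#E. g e) = (\<Sum>k<n. of_nat ((?c k)\<^sup>2) * g (?l k))" if "g 0 = 0"
    for g :: "complex \<Rightarrow> complex"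
    using sum_mset_eq_of_power_sums[of "{..<n}" E "\<lambda>k. of_nat ((?c k)\<^sup>2)" ?l g]
      power_sums_cayley_cycles(2)[OF _ ne] that by (simp add: E')
  have upto: "{..<n} = {..n - 1}" using n by auto

  have integral: "graph_integral (Sym n) (cayley_adj (full_cycles n))"
  proof -
    \<comment> \<open>Summed over the spectrum this counts the non-integral eigenvalues; it vanishes
      at 0 and at every hook eigenvalue.\<close>
    let ?g = "\<lambda>e. if e \<in> \<int> then 0 else 1 :: complex"
    have "(\<Sum>e\<in>#E. ?g e) = of_nat (size {#e \<in># E. e \<notin> \<int>#})" by (induction E) auto
    moreover have "(\<Sum>e\<in>#E. ?g e) = 0" by (subst sum_E) auto
    ultimately have "{#e \<in># E. e \<notin> \<int>#} = {#}" by (metis of_nat_eq_0_iff size_eq_0_iff_empty)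
    then have "set_mset {#e \<in># E. e \<notin> \<int>#} = {}" by (simp only: set_mset_empty)
    then have "\<forall>e\<in>#E. e \<in> \<int>" by auto
    then show ?thesis by (simp add: graph_integral_def E_def)
  qed

  have energy: "graph_energy (Sym n) (cayley_adj (full_cycles n)) = 2 ^ (n - 1) * fact (n - 1)"
  proof -
    have norm: "real (?c k) * cmod (?l k) = fact (n - 1)" if "k < n" for k
    proof -
      have "real (?c k) * cmod (?l k) = \<bar>real_of_int (hook_eigenvalue n k * int (?c k))\<bar>"
        by (simp add: abs_mult mult.commute)
      also have "\<dots> = fact (n - 1)"
        unfolding hook_eigenvalue_times_binomial[OF that] by (simp add: abs_mult power_abs)
      finally show ?thesis .
    qed
    have "complex_of_real (\<Sum>e\<in>#E. cmod e) = (\<Sum>e\<in>#E. complex_of_real (cmod e))"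
      by (induction E) auto
    also have "\<dots> = complex_of_real (\<Sum>k<n. (real (?c k))\<^sup>2 * cmod (?l k))"
      by (subst sum_E) auto
    finally have "(\<Sum>e\<in>#E. cmod e) = (\<Sum>k<n. (real (?c k))\<^sup>2 * cmod (?l k))"
      by (simp only: of_real_eq_iff)
    also have "\<dots> = (\<Sum>k<n. real (?c k) * fact (n - 1))"
      by (intro sum.cong refl) (simp only: norm power2_eq_square mult.assoc lessThan_iff)
    also have "\<dots> = real (\<Sum>k\<le>n - 1. ?c k) * fact (n - 1)"
      by (simp add: upto sum_distrib_right)
    finally show ?thesis by (simp add: graph_energy_def E_def choose_row_sum)
  qed

  have "int (graph_nullity (Sym n) (cayley_adj (full_cycles n)))
           = int (fact n) - int ((2 * n - 2) choose (n - 1))"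
  proof -
    \<comment> \<open>This counts the nonzero eigenvalues. No hook eigenvalue is zero, so the count
      is the full sum of squared degrees, a central binomial coefficient by Vandermonde.\<close>
    let ?g = "\<lambda>e. if e = 0 then 0 else 1 :: complex"
    have nz: "?l k \<noteq> 0" for k by (simp add: hook_eigenvalue_def)
    have "of_nat (size E) = of_nat (count E 0) + (\<Sum>e\<in>#E. ?g e)" by (induction E) auto
    also have "(\<Sum>e\<in>#E. ?g e) = of_nat (\<Sum>k<n. (?c k)\<^sup>2)"
      by (subst sum_E) (use nz in auto)
    also have "(\<Sum>k<n. (?c k)\<^sup>2) = (2 * n - 2) choose (n - 1)"
      using choose_square_sum[of "n - 1"] by (simp add: upto right_diff_distrib')
    finally have "complex_of_nat (fact n) = of_nat (count E 0 + ((2 * n - 2) choose (n - 1)))"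
      by (simp only: size of_nat_add)
    then have "fact n = count E 0 + ((2 * n - 2) choose (n - 1))" by (simp only: of_nat_eq_iff)
    then show ?thesis by (simp add: graph_nullity_def E_def)
  qed

  moreover have "hyperenergetic (Sym n) (cayley_adj (full_cycles n))"
  proof -
    have "real (card (Sym n)) = fact n" by (simp add: Sym_def card_permutations)
    moreover have "2 * fact n = (2 * real n) * fact (n - 1)" using n by (simp add: fact_reduce)
    moreover have "(2 * real n) * fact (n - 1) \<le> 2 ^ (n - 1) * fact (n - 1)"
    proof (rule mult_right_mono)
      have "real (2 * n) \<le> real (2 ^ (n - 1))"
        using two_power_ge_double[OF assms] by (simp only: of_nat_le_iff)
      then show "2 * real n \<le> 2 ^ (n - 1)" by simp
    qed simp
    \<comment> \<open>The energy is only shown to be at least \<open>2 * fact n\<close>; strictness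
      comes from the -2 in the threshold.\<close>
    ultimately show ?thesis unfolding hyperenergetic_def energy by linarith
  qed
  ultimately show ?thesis using integral energy by blast
qed

end
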